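(* Let $G$ be a countable directed graph with no sinks and let $\{P_x\}_{x\in V(G)}$ and $\{S_e\}_{e\in E(G)}$ be sets of projections and partial isometries on a Hilbert space $\mathcal{H}$ which satisfy the relations $(\dagger)$ for $G$. Assume that $\{S_e\}_{e\in E(G)}$ is pure. If $Y\in B(\mathcal{H})$ is a positive invertible operator, then the following assertions are equivalent: (i) $Y=A^*A$ for some $A\in B(\mathcal{H})$ which commutes with every $P_x$ ($x\in V(G)$) and every $S_e$ ($e\in E(G)$). (ii) $S_e^*YS_f = Y S_e^*S_f = S_e^*S_f Y$ for all $e,f\in E(G)$.
   Context: $G$ is a countable directed graph with edge set $E(G)$ and vertex set $V(G)$; $s(e)$, $r(e)$ denote the source and range vertices of an edge $e$. $G$ has no sinks if for every $x\in V(G)$ there is $e\in E(G)$ with $s(e)=x$. A family of non-zero partial isometries $\{S_e : e\in E(G)\}$ and non-zero (orthogonal) projections $\{P_x : x\in V(G)\}$ on a common Hilbert space satisfies $(\dagger)$ for $G$ if: (i) $P_xP_y=0$ for all $x\neq y$; (ii) $S_e^*S_f=0$ for all $e\neq f$; (iii) $S_e^*S_e=P_{s(e)}$ for all $e$; (iv) $\sum_{r(e)=x} S_eS_e^*\le P_x$ for all $x\in V(G)$ (strong operator convergence for infinite sums; empty sums are $0$). The free semigroupoid $\mathbb{F}^+(G)$ is the set of all vertices and all finite paths $w=e_k\cdots e_1$ of $G$ (with $s(e_{i+1})=r(e_i)$, $s(w)=s(e_1)$, $r(w)=r(e_k)$, and $s(x)=r(x)=x$ for vertices), with concatenation. $\mathcal{H}_G$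 is the Hilbert space with orthonormal basis $\{\xi_w : w\in\mathbb{F}^+(G)\}$, and for $e\in E(G)$ the partial isometry $L_e$ on $\mathcal{H}_G$ is given by $L_e\xi_w=\xi_{ew}$ if $r(w)=s(e)$ and $L_e\xi_w=0$ otherwise. For $x\in V(G)$, $\mathcal{H}_x=\overline{\mathrm{span}}\{\xi_w : s(w)=x\}$, which reduces all $L_e$. A family $\{S_e\}_{e\in E(G)}$ satisfying $(\dagger)$ is called pure if its Wold decomposition has only a pure part: there are cardinals $\alpha_x\ge 0$ ($x\in V(G)$) and a single unitary $U:\mathcal{H}\to\bigoplus_{x\in V(G)}\mathcal{H}_x^{(\alpha_x)}$ such that $US_eU^*=\bigoplus_{x\in V(G)} L_e^{(\alpha_x)}|_{\mathcal{H}_x^{(\alpha_x)}}$ for all $e\in E(G)$, where the superscript $(\alpha)$ denotes the direct sum of $\alpha$ copies. *)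

theory Defs
  imports "HOL-Analysis.Analysis" "Graph_Theory.Arc_Walk"
begin

section \<open>Complex Hilbert spaces\<close>

text \<open>
  Inner products are conjugate-linear in the first argument. Positive definiteness is contained in
  \<open>cinner_self\<close>, and completeness comes from \<^class>\<open>banach\<close>. The zero space is allowed.
\<close>

class complex_hilbert_space = banach +
  fixes scaleC :: "complex \<Rightarrow> 'a \<Rightarrow> 'a" (infixr \<open>*\<^sub>C\<close> 75)
    and cinner :: "'a \<Rightarrow> 'a \<Rightarrow> complex"
  assumes scaleC_add_right: "c *\<^sub>C (x + y) = c *\<^sub>C x + c *\<^sub>C y"
    and scaleC_add_left: "(c + d) *\<^sub>C x = c *\<^sub>C x + d *\<^sub>C x"
    and scaleC_scaleC: "c *\<^sub>C d *\<^sub>C x = (c * d) *\<^sub>C x"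
    and scaleC_of_real: "complex_of_real r *\<^sub>C x = r *\<^sub>R x"
    and cinner_commute: "cinner x y = cnj (cinner y x)"
    and cinner_add_right: "cinner x (y + z) = cinner x y + cinner x z"
    and cinner_scaleC_right: "cinner x (c *\<^sub>C y) = c * cinner x y"
    and cinner_self: "cinner x x = complex_of_real ((norm x)\<^sup>2)"

lemma vector_space_scaleC:
  "vector_space (scaleC :: complex \<Rightarrow> 'a \<Rightarrow> 'a::complex_hilbert_space)"
proof
  fix x :: 'a
  show "1 *\<^sub>C x = x" using scaleC_of_real[of 1 x] by simp
qed (simp_all add: scaleC_add_right scaleC_add_left scaleC_scaleC)

interpretation complex_vector:
  vector_space "scaleC :: complex \<Rightarrow> 'a \<Rightarrow> 'a::complex_hilbert_space"
  by (rule vector_space_scaleC)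

lemma cinner_add_left: "cinner (x + y) z = cinner x z + cinner y z"
  for x :: "'a::complex_hilbert_space"
  by (subst (1 2 3) cinner_commute) (simp add: cinner_add_right)

lemma norm_scaleC: "norm (c *\<^sub>C x) = cmod c * norm x"
  for x :: "'a::complex_hilbert_space"
proof -
  have "complex_of_real ((norm (c *\<^sub>C x))\<^sup>2) = c * cinner (c *\<^sub>C x) x"
    by (simp only: cinner_self[symmetric] cinner_scaleC_right)
  also have "cinner (c *\<^sub>C x) x = cnj c * cinner x x"
    by (subst (1 2) cinner_commute) (simp add: cinner_scaleC_right)
  also have "c * \<dots> = complex_of_real ((cmod c * norm x)\<^sup>2)"
    using complex_norm_square[of c] by (simp add: cinner_self power_mult_distrib mult_ac)
  finally have "(norm (c *\<^sub>C x))\<^sup>2 = (cmod c * norm x)\<^sup>2"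
    using of_real_eq_iff by blast
  then show ?thesis
    by (simp add: power2_eq_iff_nonneg)
qed

lemma norm_cinner_le: "cmod (cinner x y) \<le> norm x * norm y"
  for x y :: "'a::complex_hilbert_space"
proof -
  have re: "Re (cinner x z) \<le> norm x * norm z" for z
  proof -
    have "complex_of_real ((norm (x + z))\<^sup>2) =
        cinner x x + cinner z z + (cinner x z + cnj (cinner x z))"
      by (simp only: cinner_self[symmetric])
         (simp add: cinner_add_left cinner_add_right cinner_commute[of z x])
    then have "Re (complex_of_real ((norm (x + z))\<^sup>2)) =
        Re (cinner x x + cinner z z + (cinner x z + cnj (cinner x z)))"
      by (rule arg_cong)
    then have "(norm (x + z))\<^sup>2 = (norm x)\<^sup>2 + (norm z)\<^sup>2 + 2 * Re (cinner x z)"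
      by (simp add: cinner_self del: of_real_power)
    moreover have "(norm (x + z))\<^sup>2 \<le> (norm x + norm z)\<^sup>2"
      by (intro power_mono norm_triangle_ineq) simp
    ultimately show ?thesis by (simp add: power2_sum)
  qed
  define c where "c = cnj (sgn (cinner x y))"
  have "c * cinner x y = complex_of_real (cmod (cinner x y))"
  proof (cases "cinner x y = 0")
    case False
    have "cnj (cinner x y) * cinner x y = complex_of_real ((cmod (cinner x y))\<^sup>2)"
      by (simp only: complex_norm_square) simp
    with False show ?thesis
      by (simp add: c_def sgn_div_norm scaleR_conv_of_real power2_eq_square
          divide_simps mult_ac)
  qed simp
  then have "cmod (cinner x y) = Re (cinner x (c *\<^sub>C y))"
    by (simp add: cinner_scaleC_right)
  also have "\<dots> \<le> norm x * norm (c *\<^sub>C y)" by (rule re)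
  also have "\<dots> \<le> norm x * norm y"
    by (intro mult_left_mono) (simp_all add: norm_scaleC c_def norm_sgn)
  finally show ?thesis .
qed

instantiation complex :: complex_hilbert_space
begin

definition "scaleC_complex = (\<lambda>(c::complex) x::complex. c * x)"
definition "cinner_complex = (\<lambda>(x::complex) y::complex. cnj x * y)"

instance
  by standard
     (simp_all add: scaleC_complex_def cinner_complex_def algebra_simps scaleR_conv_of_real
       complex_norm_square del: of_real_power)

end


section \<open>Operators\<close>

definition bounded_clinear ::
    "('a::complex_hilbert_space \<Rightarrow> 'b::complex_hilbert_space) \<Rightarrow> bool" where
  "bounded_clinear T \<longleftrightarrow> bounded_linear T \<and> (\<forall>c x. T (c *\<^sub>C x) = c *\<^sub>C T x)"

text \<open>For \<open>T\<close> bounded, the function described here exists by the Riesz representation theorem.\<close>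

definition cadjoint ::
    "('a::complex_hilbert_space \<Rightarrow> 'b::complex_hilbert_space) \<Rightarrow> 'b \<Rightarrow> 'a" where
  "cadjoint T = (THE T'. \<forall>x y. cinner (T' y) x = cinner y (T x))"

lemma cadjoint_eqI:
  assumes "\<And>x y. cinner (T' y) x = cinner y (T x)"
  shows "cadjoint T = T'"
  unfolding cadjoint_def
proof (rule the_equality)
  fix R assume R: "\<forall>x y. cinner (R y) x = cinner y (T x)"
  show "R = T'"
  proof
    fix y
    have "cinner (R y) z = cinner (T' y) z" for z using R assms by simp
    then have "cinner z (R y) = cinner z (T' y)" for z
      by (metis cinner_commute)
    then have "cinner (R y - T' y) (R y - T' y + T' y) = cinner (R y - T' y) (T' y)"
      by simp
    then have "cinner (R y - T' y) (R y - T' y) = 0"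
      by (simp only: cinner_add_right) simp
    then show "R y = T' y" by (simp add: cinner_self)
  qed
qed (use assms in blast)

definition is_projection :: "('a::complex_hilbert_space \<Rightarrow> 'a) \<Rightarrow> bool" where
  "is_projection P \<longleftrightarrow> bounded_clinear P \<and> P \<circ> P = P \<and> cadjoint P = P"

definition partial_isometry :: "('a::complex_hilbert_space \<Rightarrow> 'a) \<Rightarrow> bool" where
  "partial_isometry T \<longleftrightarrow> bounded_clinear T \<and>
     (\<forall>h. (\<forall>k. T k = 0 \<longrightarrow> cinner k h = 0) \<longrightarrow> norm (T h) = norm h)"

definition positive_op :: "('a::complex_hilbert_space \<Rightarrow> 'a) \<Rightarrow> bool" where
  "positive_op T \<longleftrightarrow> bounded_clinear T \<and>
     (\<forall>h. cinner h (T h) \<in> \<real> \<and> 0 \<le> Re (cinner h (T h)))"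

definition op_le ::
    "('a::complex_hilbert_space \<Rightarrow> 'a) \<Rightarrow> ('a \<Rightarrow> 'a) \<Rightarrow> bool" where
  "op_le A B \<longleftrightarrow> positive_op (\<lambda>h. B h - A h)"

definition invertible_op :: "('a::complex_hilbert_space \<Rightarrow> 'a) \<Rightarrow> bool" where
  "invertible_op T \<longleftrightarrow> bounded_clinear T \<and>
     (\<exists>R. bounded_clinear R \<and> R \<circ> T = id \<and> T \<circ> R = id)"

text \<open>
  The target Hilbert space is \<open>K\<close>, a closed subspace of the ambient space \<open>'b\<close>. The adjoint of \<open>U\<close>
  as a map into \<open>K\<close> is the restriction of \<open>cadjoint U\<close> to \<open>K\<close>.
\<close>

definition unitary_onto ::
    "('a::complex_hilbert_space \<Rightarrow> 'b::complex_hilbert_space) \<Rightarrow> 'b set \<Rightarrow> bool" where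
  "unitary_onto U K \<longleftrightarrow> bounded_clinear U \<and> range U = K \<and>
     (\<forall>x y. cinner (U x) (U y) = cinner x y)"

definition closed_cspan :: "'a::complex_hilbert_space set \<Rightarrow> 'a set" where
  "closed_cspan B = closure (complex_vector.span B)"


section \<open>Hilbert space direct sums\<close>

text \<open>
  \<open>('i, 'a) l2sum\<close> is the Hilbert space direct sum of copies of \<open>'a\<close> indexed by \<open>'i\<close>; in
  particular \<open>('i, complex) l2sum\<close> is the space of square summable complex functions on \<open>'i\<close>.
\<close>

definition square_summable :: "('i \<Rightarrow> 'a::real_normed_vector) \<Rightarrow> bool" where
  "square_summable f \<longleftrightarrow> (\<lambda>i. (norm (f i))\<^sup>2) summable_on UNIV"

typedef (overloaded) ('i, 'a) l2sum =
    "{f :: 'i \<Rightarrow> 'a::complex_hilbert_space. square_summable f}"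
  morphisms l2sum_nth Abs_l2sum
  by (rule exI[of _ "\<lambda>_. 0"]) (simp add: square_summable_def)

lemma square_summable_l2sum_nth: "square_summable (l2sum_nth \<psi>)"
  using l2sum_nth[of \<psi>] by simp

lemma l2sum_nth_Abs: "square_summable f \<Longrightarrow> l2sum_nth (Abs_l2sum f) = f"
  by (simp add: Abs_l2sum_inverse)

lemma l2sum_eqI: "(\<And>i. l2sum_nth \<psi> i = l2sum_nth \<phi> i) \<Longrightarrow> \<psi> = \<phi>"
  by (metis ext l2sum_nth_inject)

definition l2norm :: "('i \<Rightarrow> 'a::real_normed_vector) \<Rightarrow> real" where
  "l2norm f = sqrt (\<Sum>\<^sub>\<infinity>i. (norm (f i))\<^sup>2)"

lemma L2_set_le_l2norm:
  assumes "square_summable f" "finite F"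
  shows "L2_set (\<lambda>i. norm (f i)) F \<le> l2norm f"
  unfolding L2_set_def l2norm_def
  by (intro real_sqrt_le_mono finite_sum_le_infsum)
     (use assms in \<open>auto simp: square_summable_def\<close>)

lemma square_summableI:
  assumes "\<And>F. finite F \<Longrightarrow> L2_set (\<lambda>i. norm (f i)) F \<le> B"
  shows "square_summable f" "l2norm f \<le> B"
proof -
  have B: "0 \<le> B" using assms[of "{}"] by simp
  have fin: "(\<Sum>i\<in>F. (norm (f i))\<^sup>2) \<le> B\<^sup>2" if "finite F" for F
    using assms[OF that] B unfolding L2_set_def
    by (metis real_sqrt_le_iff real_sqrt_unique)
  show ss: "square_summable f"
    unfolding square_summable_def
    by (intro nonneg_bdd_above_summable_on bdd_aboveI2[where M = "B\<^sup>2"]) (auto intro: fin)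
  have "(\<Sum>\<^sub>\<infinity>i. (norm (f i))\<^sup>2) \<le> B\<^sup>2"
    using ss unfolding square_summable_def by (rule infsum_le_finite_sums) (rule fin)
  then show "l2norm f \<le> B"
    unfolding l2norm_def using B by (metis abs_of_nonneg real_sqrt_abs real_sqrt_le_iff)
qed

lemma l2norm_square: "(l2norm f)\<^sup>2 = (\<Sum>\<^sub>\<infinity>i. (norm (f i))\<^sup>2)"
  unfolding l2norm_def by (intro real_sqrt_pow2 infsum_nonneg) simp

lemma l2norm_nonneg: "0 \<le> l2norm f"
  unfolding l2norm_def by (intro real_sqrt_ge_zero infsum_nonneg) simp

lemma norm_le_l2norm: "square_summable f \<Longrightarrow> norm (f i) \<le> l2norm f"
  using L2_set_le_l2norm[of f "{i}"] by simp

lemma square_summable_add: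
  assumes "square_summable f" "square_summable g"
  shows "square_summable (\<lambda>i. f i + g i)" "l2norm (\<lambda>i. f i + g i) \<le> l2norm f + l2norm g"
proof -
  have "L2_set (\<lambda>i. norm (f i + g i)) F \<le> l2norm f + l2norm g" if "finite F" for F
  proof -
    have "L2_set (\<lambda>i. norm (f i + g i)) F \<le> L2_set (\<lambda>i. norm (f i) + norm (g i)) F"
      by (intro L2_set_mono norm_triangle_ineq) simp
    also have "\<dots> \<le> L2_set (\<lambda>i. norm (f i)) F + L2_set (\<lambda>i. norm (g i)) F"
      by (rule L2_set_triangle_ineq)
    also have "\<dots> \<le> l2norm f + l2norm g"
      by (intro add_mono L2_set_le_l2norm assms that)
    finally show ?thesis .
  qed
  from square_summableI[OF this]
  show "square_summable (\<lambda>i. f i + g i)" "l2norm (\<lambda>i. f i + g i) \<le> l2norm f + l2norm g"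
    by blast+
qed

lemma square_summable_bounded:
  assumes "square_summable f" "\<And>i. norm (g i) \<le> c * norm (f i)" "0 \<le> c"
  shows "square_summable g" "l2norm g \<le> c * l2norm f"
proof -
  have "L2_set (\<lambda>i. norm (g i)) F \<le> c * l2norm f" if "finite F" for F
  proof -
    have "L2_set (\<lambda>i. norm (g i)) F \<le> L2_set (\<lambda>i. c * norm (f i)) F"
      by (intro L2_set_mono assms) simp
    also have "\<dots> = c * L2_set (\<lambda>i. norm (f i)) F"
      using assms(3) by (simp add: L2_set_right_distrib)
    also have "\<dots> \<le> c * l2norm f"
      by (intro mult_left_mono L2_set_le_l2norm assms that)
    finally show ?thesis .
  qed
  from square_summableI[OF this] show "square_summable g" "l2norm g \<le> c * l2norm f"
    by blast+
qed

lemma square_summable_scaleC: "square_summable f \<Longrightarrow> square_summable (\<lambda>i. c *\<^sub>C f i)"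
  for f :: "'i \<Rightarrow> 'a::complex_hilbert_space"
  by (rule square_summable_bounded(1)[where f = f and c = "cmod c"]) (simp_all add: norm_scaleC)

lemma square_summable_scaleR: "square_summable f \<Longrightarrow> square_summable (\<lambda>i. r *\<^sub>R f i)"
  by (rule square_summable_bounded(1)[where f = f and c = "\<bar>r\<bar>"]) simp_all

lemma square_summable_minus: "square_summable f \<Longrightarrow> square_summable (\<lambda>i. - f i)"
  by (rule square_summable_bounded(1)[where f = f and c = 1]) simp_all

lemma square_summable_diff:
  "square_summable f \<Longrightarrow> square_summable g \<Longrightarrow> square_summable (\<lambda>i. f i - g i)"
  using square_summable_add(1)[OF _ square_summable_minus, of f g] by simp

lemma square_summable_0: "square_summable (\<lambda>_. 0)"
  by (simp add: square_summable_def)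

lemma l2norm_scaleR: "l2norm (\<lambda>i. r *\<^sub>R f i) = \<bar>r\<bar> * l2norm f"
  by (simp add: l2norm_def power_mult_distrib infsum_cmult_right' real_sqrt_mult)

lemma summable_on_cinner:
  fixes f g :: "'i \<Rightarrow> 'a::complex_hilbert_space"
  assumes "square_summable f" "square_summable g"
  shows "(\<lambda>i. cinner (f i) (g i)) summable_on UNIV"
proof (rule abs_summable_summable, rule summable_on_comparison_test)
  show "(\<lambda>i. (norm (f i))\<^sup>2 + (norm (g i))\<^sup>2) summable_on UNIV"
    using assms unfolding square_summable_def by (rule summable_on_add)
next
  fix i
  have "cmod (cinner (f i) (g i)) \<le> norm (f i) * norm (g i)" by (rule norm_cinner_le)
  also have "\<dots> \<le> 2 * norm (f i) * norm (g i)" by simp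
  also have "\<dots> \<le> (norm (f i))\<^sup>2 + (norm (g i))\<^sup>2" by (rule sum_squares_bound)
  finally show "cmod (cinner (f i) (g i)) \<le> (norm (f i))\<^sup>2 + (norm (g i))\<^sup>2" .
qed simp

instantiation l2sum :: (type, complex_hilbert_space) real_normed_vector
begin

definition "0 = (Abs_l2sum (\<lambda>_. 0) ::('a, 'b) l2sum)"
definition "(\<psi>::('a, 'b) l2sum) + \<phi> = Abs_l2sum (\<lambda>i. l2sum_nth \<psi> i + l2sum_nth \<phi> i)"
definition "(\<psi>::('a, 'b) l2sum) - \<phi> = Abs_l2sum (\<lambda>i. l2sum_nth \<psi> i - l2sum_nth \<phi> i)"
definition "- (\<psi>::('a, 'b) l2sum) = Abs_l2sum (\<lambda>i. - l2sum_nth \<psi> i)"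
definition "r *\<^sub>R (\<psi>::('a, 'b) l2sum) = Abs_l2sum (\<lambda>i. r *\<^sub>R l2sum_nth \<psi> i)"
definition "norm (\<psi>::('a, 'b) l2sum) = sqrt (\<Sum>\<^sub>\<infinity>i. (norm (l2sum_nth \<psi> i))\<^sup>2)"
definition "dist (\<psi>::('a, 'b) l2sum) \<phi> = norm (\<psi> - \<phi>)"
definition "sgn (\<psi>::('a, 'b) l2sum) = inverse (norm \<psi>) *\<^sub>R \<psi>"
definition [code del]: "uniformity =
  (INF e\<in>{0<..}. principal {(\<psi>::('a, 'b) l2sum, \<phi>). dist \<psi> \<phi> < e})"
definition [code del]: "open (M::('a, 'b) l2sum set) \<longleftrightarrow>
  (\<forall>\<psi>\<in>M. \<forall>\<^sub>F (\<psi>', \<phi>) in uniformity. \<psi>' = \<psi> \<longrightarrow> \<phi> \<in> M)"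

lemma l2sum_nth_zero [simp]: "l2sum_nth (0::('a, 'b) l2sum) i = 0"
  by (simp add: zero_l2sum_def l2sum_nth_Abs square_summable_0)

lemma l2sum_nth_add [simp]: "l2sum_nth ((\<psi>::('a, 'b) l2sum) + \<phi>) i = l2sum_nth \<psi> i + l2sum_nth \<phi> i"
  by (simp add: plus_l2sum_def l2sum_nth_Abs square_summable_add square_summable_l2sum_nth)

lemma l2sum_nth_diff [simp]: "l2sum_nth ((\<psi>::('a, 'b) l2sum) - \<phi>) i = l2sum_nth \<psi> i - l2sum_nth \<phi> i"
  by (simp add: minus_l2sum_def l2sum_nth_Abs square_summable_diff square_summable_l2sum_nth)

lemma l2sum_nth_minus [simp]: "l2sum_nth (- (\<psi>::('a, 'b) l2sum)) i = - l2sum_nth \<psi> i"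
  by (simp add: uminus_l2sum_def l2sum_nth_Abs square_summable_minus square_summable_l2sum_nth)

lemma l2sum_nth_scaleR [simp]: "l2sum_nth (r *\<^sub>R (\<psi>::('a, 'b) l2sum)) i = r *\<^sub>R l2sum_nth \<psi> i"
  by (simp add: scaleR_l2sum_def l2sum_nth_Abs square_summable_scaleR square_summable_l2sum_nth)

lemma norm_l2sum_eq: "norm (\<psi>::('a, 'b) l2sum) = l2norm (l2sum_nth \<psi>)"
  by (simp add: norm_l2sum_def l2norm_def)

instance
proof
  fix \<psi> \<phi> \<eta> :: "('a, 'b) l2sum" and r s :: real
  show "\<psi> + \<phi> + \<eta> = \<psi> + (\<phi> + \<eta>)" by (rule l2sum_eqI) (simp add: add.assoc)
  show "\<psi> + \<phi> = \<phi> + \<psi>" by (rule l2sum_eqI) (simp add: add.commute)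
  show "0 + \<psi> = \<psi>" by (rule l2sum_eqI) simp
  show "- \<psi> + \<psi> = 0" by (rule l2sum_eqI) simp
  show "\<psi> - \<phi> = \<psi> + - \<phi>" by (rule l2sum_eqI) simp
  show "r *\<^sub>R (\<psi> + \<phi>) = r *\<^sub>R \<psi> + r *\<^sub>R \<phi>"
    by (rule l2sum_eqI) (simp add: scaleR_add_right)
  show "(r + s) *\<^sub>R \<psi> = r *\<^sub>R \<psi> + s *\<^sub>R \<psi>" by (rule l2sum_eqI) (simp add: scaleR_add_left)
  show "r *\<^sub>R s *\<^sub>R \<psi> = (r * s) *\<^sub>R \<psi>" by (rule l2sum_eqI) simp
  show "1 *\<^sub>R \<psi> = \<psi>" by (rule l2sum_eqI) simp
  show "dist \<psi> \<phi> = norm (\<psi> - \<phi>)" by (rule dist_l2sum_def)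
  show "sgn \<psi> = inverse (norm \<psi>) *\<^sub>R \<psi>" by (rule sgn_l2sum_def)
  show "uniformity =
      (INF e\<in>{0<..}. principal {(\<psi>::('a, 'b) l2sum, \<phi>). dist \<psi> \<phi> < e})"
    by (rule uniformity_l2sum_def)
  show "open M \<longleftrightarrow> (\<forall>\<psi>\<in>M. \<forall>\<^sub>F (\<psi>', \<phi>) in uniformity. \<psi>' = \<psi> \<longrightarrow> \<phi> \<in> M)"
    for M :: "('a, 'b) l2sum set"
    by (rule open_l2sum_def)
  have nth_le: "norm (l2sum_nth \<psi> i) \<le> norm \<psi>" for i
    by (simp add: norm_l2sum_eq norm_le_l2norm square_summable_l2sum_nth)
  show "norm \<psi> = 0 \<longleftrightarrow> \<psi> = 0"
  proof
    assume "norm \<psi> = 0"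
    with nth_le show "\<psi> = 0" by (intro l2sum_eqI) simp
  qed (simp add: norm_l2sum_def)
  show "norm (\<psi> + \<phi>) \<le> norm \<psi> + norm \<phi>"
    using square_summable_add(2)[OF square_summable_l2sum_nth square_summable_l2sum_nth, of \<psi> \<phi>]
    by (simp add: norm_l2sum_eq l2norm_def)
  show "norm (r *\<^sub>R \<psi>) = \<bar>r\<bar> * norm \<psi>"
    using l2norm_scaleR[of r "l2sum_nth \<psi>"] by (simp add: norm_l2sum_eq l2norm_def)
qed

end

instance l2sum :: (type, complex_hilbert_space) banach
proof
  fix X :: "nat \<Rightarrow> ('a, 'b) l2sum"
  assume X: "Cauchy X"
  have nth_le: "norm (l2sum_nth \<psi> i) \<le> norm \<psi>" for \<psi> :: "('a, 'b) l2sum" and i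
    by (simp add: norm_l2sum_eq norm_le_l2norm square_summable_l2sum_nth)
  have norm_diff: "norm (\<psi> - \<phi>) = l2norm (\<lambda>i. l2sum_nth \<psi> i - l2sum_nth \<phi> i)"
    for \<psi> \<phi> :: "('a, 'b) l2sum"
    by (simp add: norm_l2sum_eq l2norm_def)
  have cauchy: "\<exists>N. \<forall>m\<ge>N. \<forall>n\<ge>N. norm (X m - X n) < e" if "0 < e" for e
    using X that unfolding Cauchy_def dist_l2sum_def by blast
  have "Cauchy (\<lambda>n. l2sum_nth (X n) i)" for i
    unfolding Cauchy_def dist_norm
  proof (intro allI impI)
    fix e :: real assume "0 < e"
    with cauchy obtain N where "\<forall>m\<ge>N. \<forall>n\<ge>N. norm (X m - X n) < e" by blast
    then show "\<exists>N. \<forall>m\<ge>N. \<forall>n\<ge>N. norm (l2sum_nth (X m) i - l2sum_nth (X n) i) < e"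
      by (metis l2sum_nth_diff nth_le order_le_less_trans)
  qed
  then have "\<forall>i. \<exists>l. (\<lambda>n. l2sum_nth (X n) i) \<longlonglongrightarrow> l"
    by (simp add: Cauchy_convergent convergent_def[symmetric])
  then obtain f where f: "\<And>i. (\<lambda>n. l2sum_nth (X n) i) \<longlonglongrightarrow> f i" by metis
  have key: "\<exists>N. \<forall>n\<ge>N. square_summable (\<lambda>i. l2sum_nth (X n) i - f i) \<and>
      l2norm (\<lambda>i. l2sum_nth (X n) i - f i) \<le> e" if e: "0 < e" for e
  proof -
    obtain N where N: "\<And>m n. m \<ge> N \<Longrightarrow> n \<ge> N \<Longrightarrow> norm (X n - X m) < e"
      using cauchy[OF e] by blast
    have *: "L2_set (\<lambda>i. norm (l2sum_nth (X n) i - f i)) F \<le> e"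
      if n: "n \<ge> N" and F: "finite F" for n F
    proof (rule LIMSEQ_le_const2)
      show "(\<lambda>m. L2_set (\<lambda>i. norm (l2sum_nth (X n) i - l2sum_nth (X m) i)) F)
          \<longlonglongrightarrow> L2_set (\<lambda>i. norm (l2sum_nth (X n) i - f i)) F"
        unfolding L2_set_def by (intro tendsto_intros f)
      have "L2_set (\<lambda>i. norm (l2sum_nth (X n) i - l2sum_nth (X m) i)) F \<le> e" if "m \<ge> N" for m
      proof -
        have "L2_set (\<lambda>i. norm (l2sum_nth (X n) i - l2sum_nth (X m) i)) F \<le> norm (X n - X m)"
          unfolding norm_diff
          by (intro L2_set_le_l2norm square_summable_diff square_summable_l2sum_nth F)
        with N[OF that n] show ?thesis by simp
      qed
      then show "\<exists>M. \<forall>m\<ge>M. L2_set (\<lambda>i. norm (l2sum_nth (X n) i - l2sum_nth (X m) i)) F \<le> e"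
        by blast
    qed
    show ?thesis
      by (intro exI[of _ N] allI impI conjI square_summableI[where B = e] *)
  qed
  obtain n where "square_summable (\<lambda>i. l2sum_nth (X n) i - f i)"
    using key[of 1] by (metis order_refl zero_less_one)
  from square_summable_diff[OF square_summable_l2sum_nth[of "X n"] this]
  have ss: "square_summable f" by simp
  have "X \<longlonglongrightarrow> Abs_l2sum f"
    unfolding tendsto_iff eventually_sequentially
  proof (intro allI impI)
    fix e :: real assume "0 < e"
    with key[of "e / 2"] obtain N
      where "\<forall>n\<ge>N. l2norm (\<lambda>i. l2sum_nth (X n) i - f i) \<le> e / 2" by auto
    moreover have "dist (X n) (Abs_l2sum f) = l2norm (\<lambda>i. l2sum_nth (X n) i - f i)" for n
      by (simp add: dist_norm norm_diff l2sum_nth_Abs[OF ss])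
    ultimately show "\<exists>N. \<forall>n\<ge>N. dist (X n) (Abs_l2sum f) < e"
      using \<open>0 < e\<close> by (intro exI[of _ N]) fastforce
  qed
  then show "convergent X" by (rule convergentI)
qed

instantiation l2sum :: (type, complex_hilbert_space) complex_hilbert_space
begin

definition "c *\<^sub>C (\<psi>::('a, 'b) l2sum) = Abs_l2sum (\<lambda>i. c *\<^sub>C l2sum_nth \<psi> i)"
definition "cinner (\<psi>::('a, 'b) l2sum) \<phi> =
  (\<Sum>\<^sub>\<infinity>i. cinner (l2sum_nth \<psi> i) (l2sum_nth \<phi> i))"

lemma l2sum_nth_scaleC [simp]: "l2sum_nth (c *\<^sub>C (\<psi>::('a, 'b) l2sum)) i = c *\<^sub>C l2sum_nth \<psi> i"
  by (simp add: scaleC_l2sum_def l2sum_nth_Abs square_summable_scaleC square_summable_l2sum_nth)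

instance
proof
  fix \<psi> \<phi> \<eta> :: "('a, 'b) l2sum" and r :: real and c d :: complex
  show "c *\<^sub>C (\<psi> + \<phi>) = c *\<^sub>C \<psi> + c *\<^sub>C \<phi>" by (rule l2sum_eqI) (simp add: scaleC_add_right)
  show "(c + d) *\<^sub>C \<psi> = c *\<^sub>C \<psi> + d *\<^sub>C \<psi>" by (rule l2sum_eqI) (simp add: scaleC_add_left)
  show "c *\<^sub>C d *\<^sub>C \<psi> = (c * d) *\<^sub>C \<psi>" by (rule l2sum_eqI) (simp add: scaleC_scaleC)
  show "complex_of_real r *\<^sub>C \<psi> = r *\<^sub>R \<psi>" by (rule l2sum_eqI) (simp add: scaleC_of_real)
  show "cinner \<psi> \<phi> = cnj (cinner \<phi> \<psi>)"
    unfolding cinner_l2sum_def infsum_cnj[symmetric] by (subst cinner_commute) (rule refl)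
  show "cinner \<psi> (\<phi> + \<eta>) = cinner \<psi> \<phi> + cinner \<psi> \<eta>"
    by (simp add: cinner_l2sum_def cinner_add_right infsum_add summable_on_cinner
        square_summable_l2sum_nth)
  show "cinner \<psi> (c *\<^sub>C \<phi>) = c * cinner \<psi> \<phi>"
    by (simp add: cinner_l2sum_def cinner_scaleC_right infsum_cmult_right')
  have "cinner \<psi> \<psi> = complex_of_real (\<Sum>\<^sub>\<infinity>i. (norm (l2sum_nth \<psi> i))\<^sup>2)"
    unfolding cinner_l2sum_def cinner_self
    by (intro infsumI has_sum_of_real has_sum_infsum
        square_summable_l2sum_nth[unfolded square_summable_def])
  then show "cinner \<psi> \<psi> = complex_of_real ((norm \<psi>)\<^sup>2)"
    by (simp only: norm_l2sum_eq l2norm_square)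
qed

end

definition l2basis :: "'i \<Rightarrow> ('i, complex) l2sum" where
  "l2basis i = Abs_l2sum (\<lambda>j. if j = i then 1 else 0)"

lemma l2sum_nth_l2basis: "l2sum_nth (l2basis i) j = (if j = i then 1 else 0)"
proof -
  have "square_summable (\<lambda>j. if j = i then 1 else 0 :: complex)"
    unfolding square_summable_def
    by (rule finite_nonzero_values_imp_summable_on, rule finite_subset[of _ "{i}"]) auto
  then show ?thesis by (simp add: l2basis_def l2sum_nth_Abs)
qed

text \<open>
  If every \<open>K i\<close> is a closed subspace of \<open>'a\<close>, then \<open>subspace_dsum K\<close> is their orthogonal direct
  sum. The operator \<open>op_ampliation T\<close> is meant for bounded \<open>T\<close> only.
\<close>

definition subspace_dsum ::
    "('i \<Rightarrow> 'a::complex_hilbert_space set) \<Rightarrow> ('i, 'a) l2sum set" where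
  "subspace_dsum K = {\<psi>. \<forall>i. l2sum_nth \<psi> i \<in> K i}"

definition op_ampliation ::
    "('a::complex_hilbert_space \<Rightarrow> 'a) \<Rightarrow> ('i, 'a) l2sum \<Rightarrow> ('i, 'a) l2sum" where
  "op_ampliation T \<psi> = Abs_l2sum (\<lambda>i. T (l2sum_nth \<psi> i))"

lemma l2sum_nth_op_ampliation:
  assumes "bounded_clinear T"
  shows "l2sum_nth (op_ampliation T \<psi>) i = T (l2sum_nth \<psi> i)"
proof -
  obtain c where "0 \<le> c" "\<And>x. norm (T x) \<le> c * norm x"
    using assms bounded_linear.nonneg_bounded unfolding bounded_clinear_def
    by (metis mult.commute)
  then have "square_summable (\<lambda>i. T (l2sum_nth \<psi> i))"
    using square_summable_bounded(1)[OF square_summable_l2sum_nth] by metis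
  then show ?thesis by (simp add: op_ampliation_def l2sum_nth_Abs)
qed


section \<open>The free semigroupoid of a directed graph\<close>

text \<open>
  The source of an edge is its \<^const>\<open>tail\<close>, the range its \<^const>\<open>head\<close>. The path
  \<open>w = e\<^sub>k \<cdots> e\<^sub>1\<close> is the pair \<open>(s(w), [e\<^sub>1, \<dots>, e\<^sub>k])\<close>, edges listed in the order of traversal,
  and the vertex \<open>x\<close> is \<open>(x, [])\<close>. Hence \<open>e w\<close> appends \<open>e\<close> at the end of the list.
\<close>

definition free_semigroupoid :: "('v, 'e) pre_digraph \<Rightarrow> ('v \<times> 'e list) set" where
  "free_semigroupoid G = {(x, p). \<exists>y. pre_digraph.awalk G x p y}"

definition path_range :: "('v, 'e) pre_digraph \<Rightarrow> 'v \<times> 'e list \<Rightarrow> 'v" where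
  "path_range G w = (THE y. pre_digraph.awalk G (fst w) (snd w) y)"

definition no_sinks :: "('v, 'e) pre_digraph \<Rightarrow> bool" where
  "no_sinks G \<longleftrightarrow> (\<forall>x\<in>verts G. \<exists>e\<in>arcs G. tail G e = x)"

text \<open>
  The left creation operator on square summable functions: \<open>L\<^sub>e \<xi>\<close> takes the value \<open>\<xi>(w)\<close> at
  \<open>e w\<close> and vanishes at all other paths. The action on the basis is recorded in \<open>L_op_l2basis\<close>.
  The ambient space is indexed by all pairs; the basis vectors of the Fock space of the graph are
  those indexed by \<^const>\<open>free_semigroupoid\<close>.
\<close>

definition L_op :: "('v, 'e) pre_digraph \<Rightarrow> 'e \<Rightarrow>
    ('v \<times> 'e list, complex) l2sum \<Rightarrow> ('v \<times> 'e list, complex) l2sum" where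
  "L_op G e \<xi> = Abs_l2sum (\<lambda>(x, p).
     if (x, p) \<in> free_semigroupoid G \<and> p \<noteq> [] \<and> last p = e
     then l2sum_nth \<xi> (x, butlast p) else 0)"

definition H_sub :: "('v, 'e) pre_digraph \<Rightarrow> 'v \<Rightarrow> ('v \<times> 'e list, complex) l2sum set" where
  "H_sub G x = closed_cspan {l2basis w |w. w \<in> free_semigroupoid G \<and> fst w = x}"

lemma L_op_square_summable:
  fixes G :: "('v, 'e) pre_digraph" and e :: 'e and \<xi> :: "('v \<times> 'e list, complex) l2sum"
  defines "g \<equiv> (\<lambda>(x, p). if (x, p) \<in> free_semigroupoid G \<and> p \<noteq> [] \<and> last p = e
     then l2sum_nth \<xi> (x, butlast p) else 0)"
  shows "square_summable g" "l2norm g \<le> norm \<xi>"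
proof -
  have "L2_set (\<lambda>i. norm (g i)) F \<le> norm \<xi>" if F: "finite F" for F
  proof -
    define D where "D = {(x, p). (x, p) \<in> F \<and> p \<noteq> [] \<and> last p = e}"
    define b where "b = (\<lambda>(x::'v, p::'e list). (x, butlast p))"
    have D: "finite D" "D \<subseteq> F" using F unfolding D_def by (auto intro: finite_subset)
    have inj: "inj_on b D"
    proof (rule inj_onI)
      fix v w assume vw: "v \<in> D" "w \<in> D" "b v = b w"
      obtain x p y q where "v = (x, p)" "w = (y, q)" by (metis surj_pair)
      moreover from this vw have "x = y" "butlast p @ [last p] = butlast q @ [last q]"
          "p \<noteq> []" "q \<noteq> []"
        by (auto simp: D_def b_def)
      ultimately show "v = w" by simp
    qed
    have "(\<Sum>i\<in>F. (norm (g i))\<^sup>2) = (\<Sum>i\<in>D. (norm (g i))\<^sup>2)"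
      by (rule sum.mono_neutral_right) (use F D in \<open>auto simp: g_def D_def split: if_splits\<close>)
    also have "\<dots> \<le> (\<Sum>i\<in>D. (norm (l2sum_nth \<xi> (b i)))\<^sup>2)"
      by (rule sum_mono) (auto simp: g_def b_def)
    also have "\<dots> = (\<Sum>i\<in>b ` D. (norm (l2sum_nth \<xi> i))\<^sup>2)"
      by (simp add: sum.reindex[OF inj])
    finally have "L2_set (\<lambda>i. norm (g i)) F \<le> L2_set (\<lambda>i. norm (l2sum_nth \<xi> i)) (b ` D)"
      by (simp add: L2_set_def)
    also have "\<dots> \<le> norm \<xi>"
      unfolding norm_l2sum_eq using D
      by (intro L2_set_le_l2norm square_summable_l2sum_nth) simp
    finally show ?thesis .
  qed
  from square_summableI[OF this] show "square_summable g" "l2norm g \<le> norm \<xi>"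
    by blast+
qed

lemma l2sum_nth_L_op:
  "l2sum_nth (L_op G e \<xi>) (x, p) = (if (x, p) \<in> free_semigroupoid G \<and> p \<noteq> [] \<and> last p = e
     then l2sum_nth \<xi> (x, butlast p) else 0)"
  by (simp add: L_op_def l2sum_nth_Abs[OF L_op_square_summable(1)])

lemma bounded_clinear_L_op: "bounded_clinear (L_op G e)"
proof -
  have "norm (L_op G e \<xi>) \<le> norm \<xi> * 1" for \<xi>
    using L_op_square_summable(2)[of G e \<xi>]
    by (subst norm_l2sum_eq) (simp add: L_op_def l2sum_nth_Abs[OF L_op_square_summable(1)])
  then have "bounded_linear (L_op G e)"
    by (intro bounded_linear_intro[where K = 1] l2sum_eqI)
       (auto simp: l2sum_nth_L_op)
  then show ?thesis
    unfolding bounded_clinear_def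
    by (auto intro!: l2sum_eqI simp: l2sum_nth_L_op)
qed

lemma awalk_append_arc_iff:
  assumes "wf_digraph G"
  shows "pre_digraph.awalk G x (p @ [e]) y \<longleftrightarrow>
    pre_digraph.awalk G x p (tail G e) \<and> e \<in> arcs G \<and> y = head G e"
proof -
  interpret wf_digraph G by fact
  show ?thesis by (auto simp: awalk_simps arc_implies_awalk)
qed

lemma path_range_eq:
  assumes "wf_digraph G" "pre_digraph.awalk G x p y"
  shows "path_range G (x, p) = y"
proof -
  interpret wf_digraph G by fact
  show ?thesis
    unfolding path_range_def fst_conv snd_conv
    by (metis (mono_tags, lifting) assms(2) awalkE the_equality)
qed

lemma L_op_l2basis:
  assumes G: "wf_digraph G" and "e \<in> arcs G" and w: "(x, p) \<in> free_semigroupoid G"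
  shows "L_op G e (l2basis (x, p)) =
    (if path_range G (x, p) = tail G e then l2basis (x, p @ [e]) else 0)"
proof -
  obtain y where y: "pre_digraph.awalk G x p y"
    using w by (auto simp: free_semigroupoid_def)
  have ew: "(x, p @ [e]) \<in> free_semigroupoid G \<longleftrightarrow> path_range G (x, p) = tail G e"
    using assms y path_range_eq[OF G y] path_range_eq[OF G, of x p "tail G e"]
    by (auto simp: free_semigroupoid_def awalk_append_arc_iff)
  show ?thesis
  proof (rule l2sum_eqI)
    fix v :: "'a \<times> 'b list"
    obtain x' q where v: "v = (x', q)" by (cases v)
    show "l2sum_nth (L_op G e (l2basis (x, p))) v = l2sum_nth
        (if path_range G (x, p) = tail G e then l2basis (x, p @ [e]) else 0) v"
      using ew unfolding v l2sum_nth_L_op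
      by (cases q rule: rev_cases) (auto simp: l2sum_nth_l2basis)
  qed
qed


section \<open>Families of partial isometries associated with a graph\<close>

text \<open>
  The relations \<open>(\<dagger>)\<close>. The sum in the last one converges in the strong operator topology;
  boundedness of the sum is part of \<^const>\<open>op_le\<close>.
\<close>

definition dagger_family :: "('v, 'e) pre_digraph \<Rightarrow>
    ('v \<Rightarrow> 'h::complex_hilbert_space \<Rightarrow> 'h) \<Rightarrow> ('e \<Rightarrow> 'h \<Rightarrow> 'h) \<Rightarrow> bool" where
  "dagger_family G P S \<longleftrightarrow>
     (\<forall>x\<in>verts G. is_projection (P x) \<and> P x \<noteq> (\<lambda>_. 0)) \<and>
     (\<forall>e\<in>arcs G. partial_isometry (S e) \<and> S e \<noteq> (\<lambda>_. 0)) \<and>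
     (\<forall>x\<in>verts G. \<forall>y\<in>verts G. x \<noteq> y \<longrightarrow> P x \<circ> P y = (\<lambda>_. 0)) \<and>
     (\<forall>e\<in>arcs G. \<forall>f\<in>arcs G. e \<noteq> f \<longrightarrow> cadjoint (S e) \<circ> S f = (\<lambda>_. 0)) \<and>
     (\<forall>e\<in>arcs G. cadjoint (S e) \<circ> S e = P (tail G e)) \<and>
     (\<forall>x\<in>verts G.
        (\<forall>h. (\<lambda>e. S e (cadjoint (S e) h)) summable_on {e\<in>arcs G. head G e = x}) \<and>
        op_le (\<lambda>h. \<Sum>\<^sub>\<infinity>e\<in>{e\<in>arcs G. head G e = x}. S e (cadjoint (S e) h)) (P x))"

text \<open>
  The cardinals \<open>\<alpha>\<^sub>x\<close> are represented by index sets \<open>J x\<close> of that cardinality, contained in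
  \<open>\<H>\<close>. This is no restriction: the spaces \<open>\<H>\<^sub>x\<close> are nonzero, so if \<open>\<alpha>\<^sub>x\<close> copies of \<open>\<H>\<^sub>x\<close> embed
  isometrically into \<open>\<H>\<close>, then \<open>\<H>\<close> contains \<open>\<alpha>\<^sub>x\<close> orthonormal vectors. The summand with index
  \<open>(x, j)\<close> is the \<open>j\<close>-th copy of \<open>\<H>\<^sub>x\<close>; summands whose index is not admissible are zero.
\<close>

definition pure_model_space ::
    "('v, 'e) pre_digraph \<Rightarrow> ('v \<Rightarrow> 'j set) \<Rightarrow>
     ('v \<times> 'j, ('v \<times> 'e list, complex) l2sum) l2sum set" where
  "pure_model_space G J =
     subspace_dsum (\<lambda>(x, j). if x \<in> verts G \<and> j \<in> J x then H_sub G x else {0})"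

definition pure_family ::
    "('v, 'e) pre_digraph \<Rightarrow> ('e \<Rightarrow> 'h::complex_hilbert_space \<Rightarrow> 'h) \<Rightarrow> bool" where
  "pure_family G S \<longleftrightarrow>
     (\<exists>(J :: 'v \<Rightarrow> 'h set) (U :: 'h \<Rightarrow> ('v \<times> 'h, ('v \<times> 'e list, complex) l2sum) l2sum).
        unitary_onto U (pure_model_space G J) \<and>
        (\<forall>e\<in>arcs G. \<forall>\<psi>\<in>pure_model_space G J.
           U (S e (cadjoint U \<psi>)) = op_ampliation (L_op G e) \<psi>))"

end

theory Submission
  imports Defs
begin

text \<open>
  If \<open>A\<close> commutes with the family, then \<open>S\<^sub>e\<^sup>* A\<^sup>* A S\<^sub>f = A\<^sup>* S\<^sub>e\<^sup>* S\<^sub>f A\<close>, and this vanishes for \<open>e \<noteq> f\<close>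
  and is \<open>A\<^sup>* A P\<^sub>x = P\<^sub>x A\<^sup>* A\<close> with \<open>x = s(e)\<close> for \<open>e = f\<close>. So the Toeplitz relations are necessary
  (\<open>gram_of_commuting_toeplitz\<close>).

  Conversely, in a graph without sinks the relations say that \<open>Y\<close> commutes with every \<open>P\<^sub>x\<close> and that
  \<open>S\<^sub>e\<^sup>* Y S\<^sub>f\<close> is \<open>Y P\<^sub>s\<^sub>(\<^sub>e\<^sub>)\<close> or \<open>0\<close>. Hence the \<open>S\<^sub>e\<close> satisfy the orthogonality relations for the inner
  product \<open>\<langle>h, Y k\<rangle>\<close> as well, and \<open>A\<^sup>* A = Y\<close> says that \<open>A\<close> is isometric from that inner product to the
  given one. Such an \<open>A\<close> commuting with all \<open>S\<^sub>e\<close> is determined by its values on the vectors that are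
  wandering for the new inner product. These form \<open>Y\<^sup>-\<^sup>1 E\<close>, where \<open>E = \<Inter>\<^sub>e ker S\<^sub>e\<^sup>*\<close> is the original
  wandering space. Let \<open>C\<close> be a selfadjoint square root of the compression of \<open>Y\<^sup>-\<^sup>1\<close> to \<open>E\<close>
  (\<open>selfadjoint_sqrt\<close>); it is invertible since \<open>Y\<^sup>-\<^sup>1\<close> is bounded below. For an orthonormal basis \<open>b\<^sub>i\<close>
  of \<open>E\<close>, the vectors \<open>u\<^sub>i = Y\<^sup>-\<^sup>1 C\<^sup>-\<^sup>1 b\<^sub>i\<close> are then orthonormal for the new inner product. By
  \<open>word_gram\<close> the families \<open>S\<^sub>w u\<^sub>i\<close> and \<open>S\<^sub>w b\<^sub>i\<close> have the same Gram matrix, each for its own inner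
  product, and \<open>factorisation_of_gram\<close> turns this into an operator \<open>A\<close> with \<open>A S\<^sub>w u\<^sub>i = S\<^sub>w b\<^sub>i\<close> and
  \<open>A\<^sup>* A = Y\<close>, and \<open>A\<close> commutes with the \<open>S\<^sub>e\<close> and \<open>P\<^sub>x\<close> because it does so on the total family \<open>S\<^sub>w u\<^sub>i\<close>.

  Both families have to be total. For the \<open>S\<^sub>w b\<^sub>i\<close> this is purity (\<open>pure_family_wandering_basis\<close>). For
  the \<open>S\<^sub>w u\<^sub>i\<close>, let \<open>h\<close> be orthogonal to all of them in the new inner product. Taking \<open>w\<close> empty, \<open>h\<close>
  is orthogonal to \<open>E\<close>. For every \<open>g\<close> the vector \<open>S\<^sub>f g - Y S\<^sub>f Y\<^sup>-\<^sup>1 g\<close> lies in \<open>E\<close>, so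
  \<open>S\<^sub>f\<^sup>* h = Y\<^sup>-\<^sup>1 S\<^sub>f\<^sup>* Y h\<close>: the old and the new adjoint of \<open>S\<^sub>f\<close> agree at \<open>h\<close>, and therefore \<open>S\<^sub>f\<^sup>* h\<close>
  has the same property as \<open>h\<close>. By induction \<open>h\<close> is orthogonal to all \<open>S\<^sub>w b\<^sub>i\<close>, so it is zero.
\<close>

section \<open>Inner products and adjoints\<close>

lemma cinner_scaleC_left: "cinner (c *\<^sub>C x) y = cnj c * cinner x y"
  for x :: "'a::complex_hilbert_space"
  by (subst (1 2) cinner_commute) (simp add: cinner_scaleC_right)

lemma cinner_scaleR_right: "cinner x (r *\<^sub>R y) = of_real r * cinner x y"
  for x :: "'a::complex_hilbert_space"
  by (simp flip: scaleC_of_real add: cinner_scaleC_right)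

lemma cinner_scaleR_left: "cinner (r *\<^sub>R x) y = of_real r * cinner x y"
  for x :: "'a::complex_hilbert_space"
  by (simp flip: scaleC_of_real add: cinner_scaleC_left)

lemma cinner_zero_right [simp]: "cinner x 0 = 0" for x :: "'a::complex_hilbert_space"
  using cinner_scaleR_right[of x 0 0] by simp

lemma cinner_zero_left [simp]: "cinner 0 x = 0" for x :: "'a::complex_hilbert_space"
  using cinner_scaleR_left[of 0 0 x] by simp

lemma cinner_diff_right: "cinner x (y - z) = cinner x y - cinner x z"
  for x :: "'a::complex_hilbert_space"
  by (metis add_diff_cancel_right' cinner_add_right diff_add_cancel)

lemma cinner_diff_left: "cinner (x - y) z = cinner x z - cinner y z"
  for x :: "'a::complex_hilbert_space"
  by (metis add_diff_cancel_right' cinner_add_left diff_add_cancel)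

lemma cinner_minus_right: "cinner x (- y) = - cinner x y" for x :: "'a::complex_hilbert_space"
  using cinner_diff_right[of x 0 y] by simp

lemma cinner_sum_right: "cinner x (sum f F) = (\<Sum>i\<in>F. cinner x (f i))"
  for x :: "'a::complex_hilbert_space"
  by (induction F rule: infinite_finite_induct) (simp_all add: cinner_add_right)

lemma cinner_sum_left: "cinner (sum f F) x = (\<Sum>i\<in>F. cinner (f i) x)"
  for x :: "'a::complex_hilbert_space"
  by (induction F rule: infinite_finite_induct) (simp_all add: cinner_add_left)

lemma cinner_self_eq_0: "cinner x x = 0 \<longleftrightarrow> x = 0" for x :: "'a::complex_hilbert_space"
  by (simp add: cinner_self)

lemma cinner_extensionality:
  fixes x :: "'a::complex_hilbert_space"
  assumes "\<And>z. cinner z x = cinner z y"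
  shows "x = y"
  using assms[of "x - y"] cinner_self_eq_0[of "x - y"] by (simp add: cinner_diff_right)

lemma cinner_eq_0_commute: "cinner x y = 0 \<longleftrightarrow> cinner y x = 0"
  for x :: "'a::complex_hilbert_space"
  by (metis cinner_commute complex_cnj_zero)

lemma bounded_linear_cinner_right: "bounded_linear (cinner x)"
  for x :: "'a::complex_hilbert_space"
  by (rule bounded_linear_intro[where K = "norm x"])
     (auto simp: cinner_add_right cinner_scaleR_right scaleR_conv_of_real mult.commute
       intro: norm_cinner_le order_trans[OF norm_cinner_le])

lemma bounded_linear_cinner_left: "bounded_linear (\<lambda>x. cinner x y)"
  for y :: "'a::complex_hilbert_space"
  by (rule bounded_linear_intro[where K = "norm y"])
     (auto simp: cinner_add_left cinner_scaleR_left scaleR_conv_of_real mult.commute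
       intro: norm_cinner_le order_trans[OF norm_cinner_le])

lemma bounded_clinearD:
  assumes "bounded_clinear T"
  shows "bounded_linear T" "T (x + y) = T x + T y" "T (x - y) = T x - T y" "T 0 = 0"
    "T (c *\<^sub>C x) = c *\<^sub>C T x" "T (r *\<^sub>R x) = r *\<^sub>R T x"
proof -
  show T: "bounded_linear T" using assms by (simp add: bounded_clinear_def)
  then interpret bounded_linear T .
  show "T (x + y) = T x + T y" "T (x - y) = T x - T y" "T 0 = 0" "T (r *\<^sub>R x) = r *\<^sub>R T x"
    by (simp_all add: add diff scaleR)
  show "T (c *\<^sub>C x) = c *\<^sub>C T x" using assms by (simp add: bounded_clinear_def)
qed

lemma bounded_clinear_id: "bounded_clinear (\<lambda>x. x)"
  by (simp add: bounded_clinear_def bounded_linear_ident)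

lemma bounded_clinear_compose:
  "bounded_clinear S \<Longrightarrow> bounded_clinear T \<Longrightarrow> bounded_clinear (\<lambda>x. S (T x))"
  unfolding bounded_clinear_def by (auto intro: bounded_linear_compose)

lemma bounded_clinear_add:
  "bounded_clinear S \<Longrightarrow> bounded_clinear T \<Longrightarrow> bounded_clinear (\<lambda>x. S x + T x)"
  unfolding bounded_clinear_def by (auto intro: bounded_linear_add simp: scaleC_add_right)

lemma bounded_clinear_diff:
  "bounded_clinear S \<Longrightarrow> bounded_clinear T \<Longrightarrow> bounded_clinear (\<lambda>x. S x - T x)"
  unfolding bounded_clinear_def
  by (auto intro: bounded_linear_sub simp: complex_vector.scale_right_diff_distrib)

lemma scaleR_scaleC_commute: "r *\<^sub>R c *\<^sub>C x = c *\<^sub>C r *\<^sub>R x" for x :: "'a::complex_hilbert_space"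
  by (simp flip: scaleC_of_real add: scaleC_scaleC mult.commute)

lemma bounded_clinear_scaleR: "bounded_clinear T \<Longrightarrow> bounded_clinear (\<lambda>x. r *\<^sub>R T x)"
  unfolding bounded_clinear_def
  by (auto intro: bounded_linear_const_scaleR simp: scaleR_scaleC_commute)

lemma norm_add_square:
  "(norm (x + y))\<^sup>2 = (norm x)\<^sup>2 + 2 * Re (cinner x y) + (norm y)\<^sup>2"
  for x y :: "'a::complex_hilbert_space"
proof -
  have "complex_of_real ((norm (x + y))\<^sup>2) = cinner (x + y) (x + y)"
    by (simp only: cinner_self)
  also have "\<dots> = of_real ((norm x)\<^sup>2) + of_real ((norm y)\<^sup>2) + (cinner x y + cnj (cinner x y))"
    unfolding cinner_add_left cinner_add_right cinner_commute[of y x]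
    by (simp add: cinner_self)
  finally have "complex_of_real ((norm (x + y))\<^sup>2) = of_real ((norm x)\<^sup>2 + (norm y)\<^sup>2 + 2 * Re (cinner x y))"
    by (simp only: complex_add_cnj of_real_add)
  then have "(norm (x + y))\<^sup>2 = (norm x)\<^sup>2 + (norm y)\<^sup>2 + 2 * Re (cinner x y)"
    by (simp only: of_real_eq_iff)
  then show ?thesis by simp
qed

text \<open>
  The representing vector minimises \<open>\<parallel>x\<parallel>\<^sup>2 - 2 Re f(x)\<close>: by the parallelogram law a minimising
  sequence is Cauchy, and at the minimum the first variation in every direction vanishes.
\<close>

lemma riesz_representation:
  fixes f :: "'a::complex_hilbert_space \<Rightarrow> complex"
  assumes f: "bounded_clinear f"
  shows "\<exists>z. \<forall>x. f x = cinner z x"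
proof -
  note lin = bounded_clinearD[OF f]
  define J where "J = (\<lambda>x. (norm x)\<^sup>2 - 2 * Re (f x))"
  obtain K where K: "\<And>x. norm (f x) \<le> norm x * K"
    using bounded_linear.bounded[OF lin(1)] by blast
  have low: "- K\<^sup>2 \<le> J x" for x
  proof -
    have "Re (f x) \<le> norm x * K" using K[of x] complex_Re_le_cmod[of "f x"] by linarith
    moreover have "0 \<le> (norm x - K)\<^sup>2" by simp
    ultimately show ?thesis by (simp add: J_def power2_diff)
  qed
  define m where "m = Inf (range J)"
  have bdd: "bdd_below (range J)" using low by (intro bdd_belowI2[where m = "- K\<^sup>2"])
  have mle: "m \<le> J x" for x unfolding m_def by (intro cInf_lower bdd) simp
  have "\<exists>x. J x < m + 1 / real (Suc n)" for n
  proof -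
    have "Inf (range J) < m + 1 / real (Suc n)" by (simp add: m_def)
    then show ?thesis using bdd by (subst (asm) cInf_less_iff) auto
  qed
  then obtain X where X: "\<And>n. J (X n) < m + 1 / real (Suc n)" by metis
  have par: "(norm (x - y))\<^sup>2 = 2 * J x + 2 * J y - 4 * J ((1/2) *\<^sub>R (x + y))" for x y
  proof -
    have "(norm (x - y))\<^sup>2 + (norm (x + y))\<^sup>2 = 2 * (norm x)\<^sup>2 + 2 * (norm y)\<^sup>2"
      using norm_add_square[of x y] norm_add_square[of x "(-1) *\<^sub>R y"]
      by (simp add: cinner_minus_right)
    moreover have "4 * (norm ((1/2) *\<^sub>R (x + y)))\<^sup>2 = (norm (x + y))\<^sup>2"
      by (simp only: norm_scaleR power_mult_distrib) (simp add: power2_eq_square)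
    moreover have "Re (f ((1/2) *\<^sub>R (x + y))) = (Re (f x) + Re (f y)) / 2"
      by (simp only: lin) simp
    ultimately show ?thesis unfolding J_def by argo
  qed
  have dX: "(norm (X i - X j))\<^sup>2 \<le> 4 / real (Suc n)" if "n \<le> i" "n \<le> j" for i j n
  proof -
    have "1 / real (Suc i) \<le> 1 / real (Suc n)" "1 / real (Suc j) \<le> 1 / real (Suc n)"
      using that by (simp_all add: frac_le)
    then show ?thesis
      using par[of "X i" "X j"] X[of i] X[of j] mle[of "(1/2) *\<^sub>R (X i + X j)"] by simp
  qed
  have "Cauchy X"
    unfolding Cauchy_def dist_norm
  proof (intro allI impI)
    fix e :: real assume e: "0 < e"
    then obtain n where n: "4 / e\<^sup>2 < real (Suc n)" using reals_Archimedean2 less_trans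
      by (metis lessI of_nat_less_iff)
    have "norm (X i - X j) < e" if "n \<le> i" "n \<le> j" for i j
    proof -
      have "4 / real (Suc n) < e\<^sup>2" using n e by (simp add: field_simps)
      then have "(norm (X i - X j))\<^sup>2 < e\<^sup>2" using dX[OF that] by simp
      then show ?thesis using e by (simp add: power_less_imp_less_base)
    qed
    then show "\<exists>M. \<forall>m\<ge>M. \<forall>n\<ge>M. norm (X m - X n) < e" by blast
  qed
  then obtain z where z: "X \<longlonglongrightarrow> z" using Cauchy_convergent convergent_def by blast
  have "(\<lambda>n. J (X n)) \<longlonglongrightarrow> J z"
    unfolding J_def by (intro tendsto_intros z bounded_linear.tendsto[OF lin(1)])
  moreover have "(\<lambda>n. m + 1 / real (Suc n)) \<longlonglongrightarrow> m + 0"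
    by (intro tendsto_intros LIMSEQ_Suc[OF lim_1_over_n])
  ultimately have "J z \<le> m + 0"
    using X by (intro LIMSEQ_le[of "\<lambda>n. J (X n)" "J z"]) (auto intro: less_imp_le)
  then have min: "J z \<le> J x" for x using mle[of x] by simp
  have re: "Re (f x) = Re (cinner z x)" for x
  proof -
    define a where "a = Re (cinner z x) - Re (f x)"
    define q where "q = (norm x)\<^sup>2 + 1"
    have q: "0 < q" by (simp add: q_def add_nonneg_pos)
    have "0 \<le> 2 * t * a + t\<^sup>2 * (norm x)\<^sup>2" for t :: real
      using min[of "z + t *\<^sub>R x"] norm_add_square[of z "t *\<^sub>R x"]
      by (simp add: J_def lin cinner_scaleR_right a_def power_mult_distrib algebra_simps)
    from this[of "- a / q"] have "0 \<le> - 2 * a\<^sup>2 / q + a\<^sup>2 / q\<^sup>2 * (q - 1)"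
      by (simp add: q_def power2_eq_square)
    also have "\<dots> = - a\<^sup>2 / q - a\<^sup>2 / q\<^sup>2"
      using q by (simp add: field_simps power2_eq_square)
    finally have "a\<^sup>2 / q + a\<^sup>2 / q\<^sup>2 \<le> 0" by simp
    moreover have "0 \<le> a\<^sup>2 / q" "0 \<le> a\<^sup>2 / q\<^sup>2" using q by simp_all
    ultimately have "a\<^sup>2 / q = 0" by linarith
    then have "a = 0" using q by simp
    then show ?thesis by (simp add: a_def)
  qed
  have "f x = cinner z x" for x
    using re[of x] re[of "\<i> *\<^sub>C x"] lin(5)[of "\<i>" x]
    by (simp add: complex_eq_iff cinner_scaleC_right scaleC_complex_def)
  then show ?thesis by blast
qed

lemma
  assumes T: "bounded_clinear T"
  shows cinner_cadjoint_left: "cinner (cadjoint T y) x = cinner y (T x)"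
    and bounded_clinear_cadjoint: "bounded_clinear (cadjoint T)"
proof -
  note lin = bounded_clinearD[OF T]
  have "\<exists>z. \<forall>x. cinner y (T x) = cinner z x" for y
  proof (rule riesz_representation)
    show "bounded_clinear (\<lambda>x. cinner y (T x))"
      unfolding bounded_clinear_def scaleC_complex_def
      by (auto intro: bounded_linear_compose[OF bounded_linear_cinner_right lin(1)]
          simp: lin cinner_scaleC_right)
  qed
  then obtain T' where T': "\<And>y x. cinner (T' y) x = cinner y (T x)" by metis
  then have eq: "cadjoint T = T'" by (intro cadjoint_eqI)
  show "cinner (cadjoint T y) x = cinner y (T x)" for x y
    by (simp add: eq T')
  have T'r: "cinner x (T' y) = cinner (T x) y" for x y
    by (metis T' cinner_commute)
  obtain K where K: "\<And>x. norm (T x) \<le> norm x * K" and "0 \<le> K"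
    using bounded_linear.nonneg_bounded[OF lin(1)] by blast
  have "norm (T' y) \<le> norm y * K" for y
  proof -
    have "cmod (of_real ((norm (T' y))\<^sup>2)) = cmod (cinner y (T (T' y)))"
      by (simp only: cinner_self[symmetric] T')
    also have "\<dots> \<le> norm y * (norm (T' y) * K)"
      using norm_cinner_le K mult_left_mono[OF K norm_ge_zero] order_trans by blast
    finally have "norm (T' y) * norm (T' y) \<le> norm (T' y) * (norm y * K)"
      by (simp add: power2_eq_square norm_mult mult_ac)
    then show ?thesis
      using \<open>0 \<le> K\<close> by (cases "T' y = 0") simp_all
  qed
  moreover have "T' (x + y) = T' x + T' y" "T' (c *\<^sub>C x) = c *\<^sub>C T' x" "T' (r *\<^sub>R x) = r *\<^sub>R T' x"
    for x y c r
    by (rule cinner_extensionality;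
        simp add: T'r cinner_add_right cinner_scaleC_right cinner_scaleR_right)+
  ultimately show "bounded_clinear (cadjoint T)"
    unfolding eq bounded_clinear_def by (blast intro: bounded_linear_intro)
qed

lemma cinner_cadjoint_right:
  "bounded_clinear T \<Longrightarrow> cinner x (cadjoint T y) = cinner (T x) y"
  by (metis cinner_cadjoint_left cinner_commute)

lemma positive_op_selfadjoint:
  assumes "positive_op T"
  shows "cinner (T x) y = cinner x (T y)"
proof -
  have T: "bounded_clinear T" and re: "\<And>h. cinner h (T h) \<in> \<real>"
    using assms by (simp_all add: positive_op_def)
  note lin = bounded_clinearD[OF T]
  define q where "q = (\<lambda>u v. cinner u (T v))"
  have im: "Im (q h h) = 0" for h
    using re[of h] by (simp add: q_def complex_is_Real_iff)
  have add: "q (u + v) (u + v) = q u u + q v v + (q u v + q v u)" for u v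
    by (simp add: q_def lin cinner_add_left cinner_add_right)
  \<comment> \<open>polarisation with \<open>x + y\<close> and \<open>x + \<i> y\<close>\<close>
  have 1: "Im (q x y + q y x) = 0"
    using im[of "x + y"] add[of x y] im[of x] im[of y] by simp
  have 2: "Im (q x (\<i> *\<^sub>C y) + q (\<i> *\<^sub>C y) x) = 0"
    using im[of "x + \<i> *\<^sub>C y"] add[of x "\<i> *\<^sub>C y"] im[of x] im[of "\<i> *\<^sub>C y"] by simp
  have "q x (\<i> *\<^sub>C y) = \<i> * q x y" "q (\<i> *\<^sub>C y) x = - \<i> * q y x"
    by (simp_all add: q_def lin cinner_scaleC_right cinner_scaleC_left)
  with 1 2 have "q x y = cnj (q y x)" by (simp add: complex_eq_iff)
  then show ?thesis by (metis q_def cinner_commute)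
qed

text \<open>
  A family that is orthogonal to no nonzero vector has dense span, so it determines bounded
  operators; passing to the adjoint of the difference avoids the closure of the span.
\<close>

lemma bounded_clinear_eq_on_total:
  assumes S: "bounded_clinear S" and T: "bounded_clinear T"
    and total: "\<And>h. (\<And>i. i \<in> I \<Longrightarrow> cinner (a i) h = 0) \<Longrightarrow> h = 0"
    and eq: "\<And>i. i \<in> I \<Longrightarrow> S (a i) = T (a i)"
  shows "S = T"
proof
  fix x
  let ?D = "\<lambda>x. S x - T x"
  have D: "bounded_clinear ?D" by (rule bounded_clinear_diff[OF S T])
  have "cadjoint ?D g = 0" for g
    by (rule total) (simp add: cinner_cadjoint_right[OF D] eq)
  then have "cinner g (?D x) = 0" for g
    by (metis cinner_cadjoint_left[OF D] cinner_zero_left)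
  then have "?D x = 0" using cinner_self_eq_0 by blast
  then show "S x = T x" by simp
qed

section \<open>Operators bounded below and their square roots\<close>

text \<open>
  For \<open>M\<close> a bound of \<open>Y\<close>, the inequality comes from expanding the positivity of \<open>Y\<close> at the vector
  \<open>h - Y h / M\<close>. When \<open>Y\<close> is invertible, it says that \<open>Y\<^sup>-\<^sup>1\<close> is bounded below by \<open>1 / M\<close>.
\<close>

lemma positive_op_lower_bound:
  assumes Y: "positive_op Y"
  obtains M where "0 < M" "\<And>h. (norm (Y h))\<^sup>2 \<le> M * Re (cinner h (Y h))"
proof -
  have lin: "bounded_clinear Y" using Y by (simp add: positive_op_def)
  obtain M where M: "0 < M" "\<And>x. norm (Y x) \<le> norm x * M"
    using bounded_linear.pos_bounded[OF bounded_clinearD(1)[OF lin]] by blast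
  show thesis
  proof (rule that[OF M(1)])
    fix h
    define k where "k = h - (1 / M) *\<^sub>R Y h"
    have "Re (cinner (Y h) (Y (Y h))) \<le> norm (Y h) * norm (Y (Y h))"
      using complex_Re_le_cmod norm_cinner_le order_trans by blast
    also have "\<dots> \<le> (norm (Y h))\<^sup>2 * M"
      using mult_left_mono[OF M(2)[of "Y h"] norm_ge_zero[of "Y h"]] by (simp add: power2_eq_square mult_ac)
    finally have 1: "Re (cinner (Y h) (Y (Y h))) \<le> (norm (Y h))\<^sup>2 * M" .
    have "Re (cinner h (Y (Y h))) = (norm (Y h))\<^sup>2" "Re (cinner (Y h) (Y h)) = (norm (Y h))\<^sup>2"
      by (simp_all add: positive_op_selfadjoint[OF Y, symmetric] cinner_self flip: of_real_power)
    moreover have "0 \<le> Re (cinner k (Y k))" using Y by (simp add: positive_op_def)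
    ultimately have "0 \<le> Re (cinner h (Y h)) - 2 * (norm (Y h))\<^sup>2 / M + Re (cinner (Y h) (Y (Y h))) / M\<^sup>2"
      by (simp add: k_def bounded_clinearD[OF lin] cinner_diff_left cinner_diff_right
          cinner_scaleR_left cinner_scaleR_right power2_eq_square diff_divide_distrib)
    also have "\<dots> \<le> Re (cinner h (Y h)) - 2 * (norm (Y h))\<^sup>2 / M + (norm (Y h))\<^sup>2 * M / M\<^sup>2"
      using 1 by (intro add_left_mono divide_right_mono) simp_all
    also have "\<dots> = Re (cinner h (Y h)) - (norm (Y h))\<^sup>2 / M"
      using M(1) by (simp add: field_simps power2_eq_square)
    finally show "(norm (Y h))\<^sup>2 \<le> M * Re (cinner h (Y h))"
      using M(1) by (simp add: field_simps)
  qed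
qed

lemma bounded_linear_scaleC: "bounded_linear (\<lambda>x. c *\<^sub>C x)" for c :: complex
  by (rule bounded_linear_intro[where K = "cmod c"])
     (simp_all add: scaleC_add_right scaleR_scaleC_commute norm_scaleC mult.commute)

text \<open>
  After scaling, \<open>T = 1 - s Z\<close> has norm at most some \<open>t < 1\<close>. The square root is \<open>1 - B\<close> for the
  solution of \<open>B = (T + B\<^sup>2)/2\<close>, a contraction of the ball of radius \<open>t\<close>. The fixed point is taken
  inside the closed set of selfadjoint operators commuting with everything that commutes with \<open>Z\<close>, so
  it inherits these properties. Bijectivity of \<open>1 - B\<close> is again a contraction argument.
\<close>

lemma selfadjoint_sqrt:
  fixes Z :: "'a::complex_hilbert_space \<Rightarrow> 'a"
  assumes Z: "bounded_clinear Z" and sa: "\<And>x y. cinner (Z x) y = cinner x (Z y)"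
    and \<delta>: "0 < \<delta>" and below: "\<And>x. \<delta> * (norm x)\<^sup>2 \<le> Re (cinner x (Z x))"
  shows "\<exists>C. bounded_clinear C \<and> (\<forall>x y. cinner (C x) y = cinner x (C y)) \<and> (\<forall>x. C (C x) = Z x) \<and>
    bij C \<and> (\<forall>K. bounded_clinear K \<longrightarrow> (\<forall>x. K (Z x) = Z (K x)) \<longrightarrow> (\<forall>x. K (C x) = C (K x)))"
proof -
  note lin = bounded_clinearD[OF Z]
  obtain M0 where M0: "\<And>x. norm (Z x) \<le> norm x * M0"
    using bounded_linear.bounded[OF lin(1)] by blast
  define M where "M = max M0 (\<delta> + 1)"
  have M: "\<delta> < M" "0 < M" and ZM: "norm (Z x) \<le> M * norm x" for x
    using \<delta> M0[of x] mult_left_mono[of M0 M "norm x"] by (auto simp: M_def mult.commute)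
  \<comment> \<open>\<open>\<parallel>x - s Z x\<parallel>\<^sup>2 \<le> (1 - 2 s \<delta> + s\<^sup>2 M\<^sup>2) \<parallel>x\<parallel>\<^sup>2\<close>, and the factor is least for \<open>s = \<delta> / M\<^sup>2\<close>;
      \<open>M\<close> is enlarged beyond \<open>\<delta>\<close> to make its least value positive\<close>
  define s where "s = \<delta> / M\<^sup>2"
  have s: "0 < s" using \<delta> M by (simp add: s_def)
  define t where "t = sqrt (1 - (\<delta> / M)\<^sup>2)"
  have dM: "0 < \<delta> / M" "\<delta> / M < 1" using \<delta> M by simp_all
  then have "(\<delta> / M)\<^sup>2 < 1" "0 < (\<delta> / M)\<^sup>2" by (auto simp: power_less_one_iff abs_square_less_1)
  then have t: "0 < t" "t < 1" and t2: "t\<^sup>2 = 1 - (\<delta> / M)\<^sup>2" by (simp_all add: t_def)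
  define T where "T = (\<lambda>x. x - s *\<^sub>R Z x)"
  have T: "bounded_clinear T"
    unfolding T_def by (intro bounded_clinear_diff bounded_clinear_id bounded_clinear_scaleR Z)
  have normT: "norm (T x) \<le> t * norm x" for x
  proof -
    have "(norm (T x))\<^sup>2 = (norm x)\<^sup>2 - 2 * s * Re (cinner x (Z x)) + s\<^sup>2 * (norm (Z x))\<^sup>2"
      using norm_add_square[of x "- (s *\<^sub>R Z x)"]
      by (simp add: T_def cinner_minus_right cinner_scaleR_right power_mult_distrib)
    also have "\<dots> \<le> (norm x)\<^sup>2 - 2 * s * (\<delta> * (norm x)\<^sup>2) + s\<^sup>2 * (M * norm x)\<^sup>2"
      using s below[of x] ZM[of x] by (intro add_mono diff_mono mult_left_mono power_mono) auto
    also have "\<dots> = (t * norm x)\<^sup>2"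
      unfolding power_mult_distrib t2 s_def using M
      by (simp add: field_simps power2_eq_square)
    finally show ?thesis using t by (simp add: power2_le_iff_abs_le)
  qed
  define TT where "TT = Blinfun T"
  have TT: "blinfun_apply TT = T"
    unfolding TT_def by (rule bounded_linear_Blinfun_apply[OF bounded_clinearD(1)[OF T]])
  define \<K> where "\<K> = {K. bounded_clinear K \<and> (\<forall>x. K (Z x) = Z (K x))}"
  have \<K>: "bounded_clinear K" "K (T x) = T (K x)" if "K \<in> \<K>" for K x
    using that bounded_clinearD(3,6)[of K] by (auto simp: \<K>_def T_def)
  define R where "R = {B. norm B \<le> t \<and> (\<forall>c x. blinfun_apply B (c *\<^sub>C x) = c *\<^sub>C B x) \<and>
    (\<forall>x y. cinner (B x) y = cinner x (B y)) \<and> (\<forall>K\<in>\<K>. \<forall>x. K (B x) = B (K x))}"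
  have "closed R"
  proof -
    have cont: "continuous_on UNIV (\<lambda>B::'a \<Rightarrow>\<^sub>L 'a. f (blinfun_apply B x))" if "bounded_linear f"
      for f :: "'a \<Rightarrow> 'b::real_normed_vector" and x
      by (rule bounded_linear.continuous_on[OF that])
         (rule bounded_linear.continuous_on[OF blinfun.bounded_linear_left continuous_on_id])
    have c0: "continuous_on UNIV (\<lambda>B::'a \<Rightarrow>\<^sub>L 'a. blinfun_apply B x)" for x
      by (rule cont[OF bounded_linear_ident])
    have c1: "continuous_on UNIV (\<lambda>B::'a \<Rightarrow>\<^sub>L 'a. c *\<^sub>C blinfun_apply B x)" for c :: complex and x
      by (rule cont[OF bounded_linear_scaleC])
    have c2: "continuous_on UNIV (\<lambda>B::'a \<Rightarrow>\<^sub>L 'a. cinner (blinfun_apply B x) y)" for x y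
      by (rule cont[OF bounded_linear_cinner_left])
    have c3: "continuous_on UNIV (\<lambda>B::'a \<Rightarrow>\<^sub>L 'a. cinner x (blinfun_apply B y))" for x y
      by (rule cont[OF bounded_linear_cinner_right])
    have c4: "continuous_on UNIV (\<lambda>B::'a \<Rightarrow>\<^sub>L 'a. K (blinfun_apply B x))" if "K \<in> \<K>" for K x
      by (rule cont[OF bounded_clinearD(1)[OF \<K>(1)[OF that]]])
    have "closed {B :: 'a \<Rightarrow>\<^sub>L 'a. \<forall>c x. blinfun_apply B (c *\<^sub>C x) = c *\<^sub>C blinfun_apply B x}"
      by (intro closed_Collect_all closed_Collect_eq c0 c1)
    moreover have "closed {B :: 'a \<Rightarrow>\<^sub>L 'a. \<forall>x y. cinner (blinfun_apply B x) y = cinner x (blinfun_apply B y)}"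
      by (intro closed_Collect_all closed_Collect_eq c2 c3)
    moreover have "closed {B. \<forall>K. K \<in> \<K> \<longrightarrow> (\<forall>x. K (blinfun_apply B x) = B (K x))}"
    proof (intro closed_Collect_all)
      fix K show "closed {B. K \<in> \<K> \<longrightarrow> (\<forall>x. K (blinfun_apply B x) = B (K x))}"
      proof (cases "K \<in> \<K>")
        case True
        have "closed {B. \<forall>x. K (blinfun_apply B x) = blinfun_apply B (K x)}"
          by (intro closed_Collect_all closed_Collect_eq c0 c4 True)
        then show ?thesis by (simp add: True)
      qed simp
    qed
    moreover have "closed {B :: 'a \<Rightarrow>\<^sub>L 'a. norm B \<le> t}"
      by (intro closed_Collect_le continuous_intros)
    ultimately show ?thesis
      unfolding R_def Ball_def by (intro closed_Collect_conj)
  qed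
  then have cR: "complete R" by (simp add: complete_eq_closed)
  have zR: "0 \<in> R" using t \<K>(1) by (auto simp: R_def bounded_clinearD(4))
  define F where "F = (\<lambda>B. (1/2) *\<^sub>R (TT + (B o\<^sub>L B)))"
  have FA: "F B x = (1/2) *\<^sub>R (T x + B (B x))" for B x
    by (simp add: F_def TT blinfun.bilinear_simps)
  have FR: "F ` R \<subseteq> R"
  proof clarify
    fix B assume B: "B \<in> R"
    then have Bt: "norm B \<le> t" and BC: "\<And>c x. B (c *\<^sub>C x) = c *\<^sub>C B x"
      and Bsa: "\<And>x y. cinner (B x) y = cinner x (B y)"
      and BK: "\<And>K x. K \<in> \<K> \<Longrightarrow> K (B x) = B (K x)" by (auto simp: R_def)
    have "norm (F B) \<le> 1/2 * (norm TT + norm (B o\<^sub>L B))"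
      by (simp add: F_def norm_triangle_ineq)
    also have "\<dots> \<le> 1/2 * (t + t * t)"
    proof (intro mult_left_mono add_mono)
      show "norm TT \<le> t" using normT t by (intro norm_blinfun_bound) (auto simp: TT)
      show "norm (B o\<^sub>L B) \<le> t * t"
        using norm_blinfun_compose[of B B] mult_mono[OF Bt Bt] t by simp
    qed simp
    also have "\<dots> \<le> t" using t by (simp add: field_simps)
    finally have "norm (F B) \<le> t" .
    moreover have "F B (c *\<^sub>C x) = c *\<^sub>C F B x" for c x
      by (simp only: FA BC bounded_clinearD(5)[OF T] scaleC_add_right[symmetric] scaleR_scaleC_commute)
    moreover have "cinner (F B x) y = cinner x (F B y)" for x y
      by (simp add: FA T_def cinner_scaleR_left cinner_scaleR_right cinner_add_left cinner_add_right
          cinner_diff_left cinner_diff_right sa Bsa)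
    moreover have "K (F B x) = F B (K x)" if "K \<in> \<K>" for K x
      by (simp only: FA bounded_clinearD(2,6)[OF \<K>(1)[OF that]] \<K>(2)[OF that] BK[OF that])
    ultimately show "F B \<in> R" by (auto simp: R_def)
  qed
  have lip: "\<forall>A\<in>R. \<forall>B\<in>R. dist (F A) (F B) \<le> t * dist A B"
  proof (intro ballI)
    fix A B assume "A \<in> R" "B \<in> R"
    then have AB: "norm A \<le> t" "norm B \<le> t" by (auto simp: R_def)
    have "F A - F B = (1/2) *\<^sub>R ((A o\<^sub>L (A - B)) + ((A - B) o\<^sub>L B))"
      by (rule blinfun_eqI) (simp add: FA blinfun.bilinear_simps algebra_simps)
    then have "norm (F A - F B) \<le> 1/2 * (norm (A o\<^sub>L (A - B)) + norm ((A - B) o\<^sub>L B))"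
      by (simp add: norm_triangle_ineq)
    also have "\<dots> \<le> 1/2 * (t * norm (A - B) + norm (A - B) * t)"
      using AB t by (intro mult_left_mono add_mono order_trans[OF norm_blinfun_compose] mult_mono) auto
    finally show "dist (F A) (F B) \<le> t * dist A B" by (simp add: dist_norm mult.commute)
  qed
  have "\<exists>!B. B \<in> R \<and> F B = B"
    by (rule Banach_fix[OF cR _ _ t(2) FR]) (use zR t lip in auto)
  then obtain B where BR: "B \<in> R" and FB: "F B = B" by blast
  then have Bt: "norm B \<le> t" and BC: "\<And>c x. B (c *\<^sub>C x) = c *\<^sub>C B x"
    and Bsa: "\<And>x y. cinner (B x) y = cinner x (B y)"
    and BK: "\<And>K x. K \<in> \<K> \<Longrightarrow> K (B x) = B (K x)" by (auto simp: R_def)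
  have Bx: "norm (B x) \<le> t * norm x" for x
    using norm_blinfun[of B x] mult_right_mono[OF Bt norm_ge_zero[of x]] by linarith
  have Beq: "2 *\<^sub>R B x = T x + B (B x)" for x
    using arg_cong[OF FA[of B x, unfolded FB], of "(*\<^sub>R) 2"] by simp
  have cB: "bounded_clinear (blinfun_apply B)"
    unfolding bounded_clinear_def by (simp add: BC blinfun.bounded_linear_right)
  define r where "r = 1 / sqrt s"
  have r: "0 < r" "r * r * s = 1" using s by (simp_all add: r_def)
  define C where "C = (\<lambda>x. r *\<^sub>R (x - B x))"
  have "bounded_clinear C"
    unfolding C_def by (intro bounded_clinear_diff bounded_clinear_id bounded_clinear_scaleR cB)
  moreover have "cinner (C x) y = cinner x (C y)" for x y
    by (simp add: C_def cinner_scaleR_left cinner_scaleR_right cinner_diff_left cinner_diff_right Bsa)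
  moreover have "C (C x) = Z x" for x
  proof -
    have "C (C x) = (r * r) *\<^sub>R (x - 2 *\<^sub>R B x + B (B x))"
      by (simp add: C_def blinfun.bilinear_simps scaleR_2 algebra_simps)
    also have "\<dots> = (r * r * s) *\<^sub>R Z x" by (simp add: Beq T_def)
    finally show ?thesis by (simp add: r)
  qed
  moreover have "bij C"
  proof (rule bijI)
    have "x = y" if "x - B x = y - B y" for x y
    proof (rule ccontr)
      assume "x \<noteq> y"
      then have "t * norm (x - y) < norm (x - y)" using t by simp
      moreover have "B (x - y) = x - y"
        using that by (simp add: blinfun.diff_right algebra_simps)
      ultimately show False using Bx[of "x - y"] by simp
    qed
    moreover have "x - B x = y - B y" if "C x = C y" for x y
      using that r by (simp add: C_def)
    ultimately show "inj C" by (blast intro: injI)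
    have "\<exists>x. y + B x = x" for y
    proof -
      have "dist (y + B u) (y + B v) \<le> t * dist u v" for u v
        using Bx[of "u - v"] by (simp add: dist_norm blinfun.diff_right)
      then have "\<exists>!x. y + B x = x" using t by (intro banach_fix_type[of t]) auto
      then show ?thesis by blast
    qed
    then have "\<exists>x. y = C x" for y
    proof -
      obtain x where "(1/r) *\<^sub>R y + B x = x" using \<open>\<And>y. \<exists>x. y + B x = x\<close> by blast
      then have "x - B x = (1/r) *\<^sub>R y" by (simp add: algebra_simps)
      then show ?thesis using r by (intro exI[of _ x]) (simp add: C_def)
    qed
    then show "surj C" by (auto simp: surj_def)
  qed
  moreover have "K (C x) = C (K x)" if "bounded_clinear K" "\<forall>x. K (Z x) = Z (K x)" for K x
  proof -
    have "K (B x) = B (K x)" by (rule BK) (use that in \<open>simp add: \<K>_def\<close>)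
    then show ?thesis by (simp only: C_def bounded_clinearD(3,6)[OF that(1)])
  qed
  ultimately show ?thesis by blast
qed

section \<open>Families with equal Gram matrices\<close>

lemma cinner_l2basis: "cinner (l2basis i) \<psi> = l2sum_nth \<psi> i"
proof -
  have "cinner (l2basis i) \<psi> = (\<Sum>\<^sub>\<infinity>j\<in>{i}. cinner (l2sum_nth (l2basis i) j) (l2sum_nth \<psi> j))"
    unfolding cinner_l2sum_def
    by (rule infsum_cong_neutral) (auto simp: l2sum_nth_l2basis cinner_complex_def)
  then show ?thesis by (simp add: l2sum_nth_l2basis cinner_complex_def)
qed

lemma Re_cinner_self_nonneg: "0 \<le> Re (cinner x x)" for x :: "'a::complex_hilbert_space"
  by (simp only: cinner_self Re_complex_of_real zero_le_power2)

text \<open>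
  This is positivity of \<open>cinner x (T y)\<close> at \<open>h\<close> minus its projection onto the span of the \<open>a i\<close>. The
  families here are orthonormal on \<open>I\<close> and null outside \<open>I\<close>, so that later on they can be indexed by
  all words, with the words that are not paths outside \<open>I\<close>.
\<close>

lemma bessel_inequality:
  fixes T :: "'a::complex_hilbert_space \<Rightarrow> 'a"
  assumes T: "bounded_clinear T" and sa: "\<And>x y. cinner (T x) y = cinner x (T y)"
    and pos: "\<And>x. 0 \<le> Re (cinner x (T x))"
    and gram: "\<And>i j. cinner (a i) (T (a j)) = (if i = j \<and> i \<in> I then 1 else 0)"
    and F: "finite F"
  shows "(\<Sum>i\<in>F. (cmod (cinner (a i) (T h)))\<^sup>2) \<le> Re (cinner h (T h))"
proof -
  note lin = bounded_clinearD[OF T]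
  define c where "c = (\<lambda>i. cinner (a i) (T h))"
  define g where "g = (\<Sum>i\<in>F. c i *\<^sub>C a i)"
  define s where "s = (\<Sum>i\<in>F. (cmod (c i))\<^sup>2)"
  have cc: "cnj (c i) * c i = of_real ((cmod (c i))\<^sup>2)" for i
    by (simp only: complex_norm_square mult.commute)
  have gh: "cinner g (T h) = of_real s"
    unfolding g_def cinner_sum_left cinner_scaleC_left s_def of_real_sum
    by (rule sum.cong[OF refl]) (simp only: cc[symmetric], simp only: c_def)
  have hg: "cinner h (T g) = of_real s"
    using gh by (metis sa cinner_commute complex_cnj_complex_of_real)
  have "T g = (\<Sum>j\<in>F. c j *\<^sub>C T (a j))"
    unfolding g_def using bounded_linear.linear[OF lin(1)] by (simp add: linear_sum lin)
  then have "cinner g (T g) = (\<Sum>i\<in>F. cnj (c i) * cinner (a i) (\<Sum>j\<in>F. c j *\<^sub>C T (a j)))"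
    by (simp only: g_def cinner_sum_left cinner_scaleC_left)
  also have "\<dots> = (\<Sum>i\<in>F. cnj (c i) * (\<Sum>j\<in>F. c j * (if i = j \<and> i \<in> I then 1 else 0)))"
    by (simp only: cinner_sum_right cinner_scaleC_right gram)
  also have "\<dots> = (\<Sum>i\<in>F. of_real (if i \<in> I then (cmod (c i))\<^sup>2 else 0))"
  proof (rule sum.cong[OF refl])
    fix i assume i: "i \<in> F"
    have "(\<Sum>j\<in>F. c j * (if i = j \<and> i \<in> I then 1 else 0)) = (\<Sum>j\<in>F. if i = j then (if i \<in> I then c i else 0) else 0)"
      by (rule sum.cong) auto
    also have "\<dots> = (if i \<in> I then c i else 0)" using i F by simp
    finally show "cnj (c i) * (\<Sum>j\<in>F. c j * (if i = j \<and> i \<in> I then 1 else 0)) =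
        of_real (if i \<in> I then (cmod (c i))\<^sup>2 else 0)"
      using cc[of i] by simp
  qed
  finally have gg: "cinner g (T g) = of_real (\<Sum>i\<in>F. if i \<in> I then (cmod (c i))\<^sup>2 else 0)"
    by simp
  have "(\<Sum>i\<in>F. if i \<in> I then (cmod (c i))\<^sup>2 else 0) \<le> s"
    unfolding s_def by (rule sum_mono) simp
  moreover have "0 \<le> Re (cinner (h - g) (T (h - g)))" by (rule pos)
  ultimately have "s \<le> Re (cinner h (T h))"
    by (simp add: lin cinner_diff_left cinner_diff_right gh hg gg)
  then show ?thesis by (simp add: s_def c_def)
qed

text \<open>
  Bessel's inequality makes the coefficients of \<open>h\<close> square summable and the coefficient map bounded.
\<close>

lemma analysis_operator:
  fixes T :: "'a::complex_hilbert_space \<Rightarrow> 'a" and a :: "'i \<Rightarrow> 'a"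
  assumes T: "bounded_clinear T" and sa: "\<And>x y. cinner (T x) y = cinner x (T y)"
    and pos: "\<And>x. 0 \<le> Re (cinner x (T x))"
    and gram: "\<And>i j. cinner (a i) (T (a j)) = (if i = j \<and> i \<in> I then 1 else 0)"
  shows "\<exists>V :: 'a \<Rightarrow> ('i, complex) l2sum. bounded_clinear V \<and>
    (\<forall>h i. l2sum_nth (V h) i = cinner (a i) (T h))"
proof -
  note lin = bounded_clinearD[OF T]
  define f where "f = (\<lambda>h i. cinner (a i) (T h))"
  have "L2_set (\<lambda>i. norm (f h i)) F \<le> sqrt (Re (cinner h (T h)))" if "finite F" for F h
    unfolding L2_set_def f_def
    by (rule real_sqrt_le_mono, rule bessel_inequality) (use assms that in auto)
  then have ss: "square_summable (f h)" "l2norm (f h) \<le> sqrt (Re (cinner h (T h)))" for h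
    using square_summableI[of "f h" "sqrt (Re (cinner h (T h)))"] by blast+
  define V where "V = (\<lambda>h. Abs_l2sum (f h))"
  have nth: "l2sum_nth (V h) i = cinner (a i) (T h)" for h i
    unfolding V_def by (subst l2sum_nth_Abs[OF ss(1)]) (simp add: f_def)
  obtain K where K: "\<And>x. norm (T x) \<le> norm x * K" "0 \<le> K"
    using bounded_linear.nonneg_bounded[OF lin(1)] by blast
  have "norm (V h) \<le> norm h * sqrt K" for h
  proof -
    have "norm (V h) \<le> sqrt (Re (cinner h (T h)))"
      unfolding norm_l2sum_eq V_def l2sum_nth_Abs[OF ss(1)] by (rule ss(2))
    also have "Re (cinner h (T h)) \<le> norm h * norm (T h)"
      using complex_Re_le_cmod norm_cinner_le order_trans by blast
    also have "\<dots> \<le> (norm h)\<^sup>2 * K"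
      using mult_left_mono[OF K(1)[of h] norm_ge_zero[of h]] by (simp add: power2_eq_square mult_ac)
    also have "sqrt \<dots> = norm h * sqrt K" by (simp add: real_sqrt_mult)
    finally show ?thesis by simp
  qed
  moreover have "V (x + y) = V x + V y" "V (r *\<^sub>R x) = r *\<^sub>R V x" "V (c *\<^sub>C x) = c *\<^sub>C V x" for x y r c
    by (rule l2sum_eqI; simp add: nth lin cinner_add_right cinner_scaleR_right cinner_scaleC_right
        scaleC_complex_def scaleR_conv_of_real)+
  ultimately have "bounded_clinear V"
    unfolding bounded_clinear_def by (blast intro: bounded_linear_intro)
  then show ?thesis using nth by blast
qed

text \<open>
  Two families with the same Gram matrix, one for the inner product \<open>cinner x (T y)\<close> and the other for
  the given one, are matched by an operator \<open>A\<close>; it is \<open>V\<^sup>* W\<close> for the two analysis operators, and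
  then \<open>A\<^sup>* A = T\<close> because the first family is total.
\<close>

lemma factorisation_of_gram:
  fixes T :: "'a::complex_hilbert_space \<Rightarrow> 'a" and a e :: "'i \<Rightarrow> 'a"
  assumes T: "bounded_clinear T" and sa: "\<And>x y. cinner (T x) y = cinner x (T y)"
    and pos: "\<And>x. 0 \<le> Re (cinner x (T x))"
    and gram_a: "\<And>i j. cinner (a i) (T (a j)) = (if i = j \<and> i \<in> I then 1 else 0)"
    and gram_e: "\<And>i j. cinner (e i) (e j) = (if i = j \<and> i \<in> I then 1 else 0)"
    and zero_a: "\<And>i. i \<notin> I \<Longrightarrow> a i = 0"
    and total_a: "\<And>h. (\<And>i. cinner (a i) h = 0) \<Longrightarrow> h = 0"
    and total_e: "\<And>h. (\<And>i. cinner (e i) h = 0) \<Longrightarrow> h = 0"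
  shows "\<exists>A. bounded_clinear A \<and> cadjoint A \<circ> A = T \<and> (\<forall>i. A (a i) = e i)"
proof -
  obtain W :: "'a \<Rightarrow> ('i, complex) l2sum" where W: "bounded_clinear W"
    and Wn: "\<And>h i. l2sum_nth (W h) i = cinner (a i) (T h)"
    using analysis_operator[OF T sa pos gram_a] by blast
  obtain V :: "'a \<Rightarrow> ('i, complex) l2sum" where V: "bounded_clinear V"
    and Vn: "\<And>h i. l2sum_nth (V h) i = cinner (e i) h"
    using analysis_operator[OF bounded_clinear_id refl Re_cinner_self_nonneg gram_e] by blast
  define A where "A = (\<lambda>h. cadjoint V (W h))"
  have A: "bounded_clinear A"
    unfolding A_def by (rule bounded_clinear_compose[OF bounded_clinear_cadjoint[OF V] W])
  have eA: "cinner (e i) (A h) = cinner (a i) (T h)" for i h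
  proof (cases "i \<in> I")
    case True
    have "V (e i) = l2basis i"
      by (rule l2sum_eqI) (use True in \<open>auto simp: Vn l2sum_nth_l2basis gram_e\<close>)
    then show ?thesis by (simp add: A_def cinner_cadjoint_right[OF V] cinner_l2basis Wn)
  next
    case False
    have "cinner (e i) (e i) = 0" unfolding gram_e using False by simp
    then have "e i = 0" by (simp only: cinner_self_eq_0)
    then show ?thesis using zero_a[OF False] by simp
  qed
  have Aa: "A (a i) = e i" for i
    using total_e[of "A (a i) - e i"] by (simp add: cinner_diff_right eA gram_a gram_e)
  have "cadjoint A (A h) = T h" for h
    using total_a[of "cadjoint A (A h) - T h"]
    by (simp add: cinner_diff_right cinner_cadjoint_right[OF A] Aa eA)
  then show ?thesis using A Aa by (intro exI[of _ A]) auto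
qed

section \<open>Words in a family satisfying the relations\<close>

text \<open>
  A word is read as the product of operators \<open>foldr S w\<close>, so its head is applied last; as a path it is
  traversed from its last letter to its first, the reverse of \<^const>\<open>pre_digraph.awalk\<close>.
\<close>

fun path_end :: "('v, 'e) pre_digraph \<Rightarrow> 'v \<Rightarrow> 'e list \<Rightarrow> 'v" where
  "path_end G v [] = v"
| "path_end G v (e # w) = head G e"

fun is_path :: "('v, 'e) pre_digraph \<Rightarrow> 'v \<Rightarrow> 'e list \<Rightarrow> bool" where
  "is_path G v [] \<longleftrightarrow> True"
| "is_path G v (e # w) \<longleftrightarrow> is_path G v w \<and> path_end G v w = tail G e"

locale dagger_graph =
  fixes G :: "('v, 'e) pre_digraph"
    and P :: "'v \<Rightarrow> 'h::complex_hilbert_space \<Rightarrow> 'h"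
    and S :: "'e \<Rightarrow> 'h \<Rightarrow> 'h"
  assumes wf: "wf_digraph G" and dagger: "dagger_family G P S"
begin

lemma tail_verts: "e \<in> arcs G \<Longrightarrow> tail G e \<in> verts G"
  and head_verts: "e \<in> arcs G \<Longrightarrow> head G e \<in> verts G"
  using wf by (simp_all add: wf_digraph_def)

lemma dagger_rules:
  "x \<in> verts G \<Longrightarrow> is_projection (P x)"
  "e \<in> arcs G \<Longrightarrow> partial_isometry (S e)"
  "x \<in> verts G \<Longrightarrow> y \<in> verts G \<Longrightarrow> x \<noteq> y \<Longrightarrow> P x \<circ> P y = (\<lambda>_. 0)"
  "e \<in> arcs G \<Longrightarrow> f \<in> arcs G \<Longrightarrow> e \<noteq> f \<Longrightarrow> cadjoint (S e) \<circ> S f = (\<lambda>_. 0)"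
  "e \<in> arcs G \<Longrightarrow> cadjoint (S e) \<circ> S e = P (tail G e)"
  "x \<in> verts G \<Longrightarrow> (\<lambda>e. S e (cadjoint (S e) h)) summable_on {e\<in>arcs G. head G e = x}"
  "x \<in> verts G \<Longrightarrow>
    op_le (\<lambda>h. \<Sum>\<^sub>\<infinity>e\<in>{e\<in>arcs G. head G e = x}. S e (cadjoint (S e) h)) (P x)"
proof -
  note D = dagger[unfolded dagger_family_def]
  note D1 = D[THEN conjunct2] and D2 = D[THEN conjunct2, THEN conjunct2]
  note D3 = D2[THEN conjunct2] and D4 = D2[THEN conjunct2, THEN conjunct2]
  note D5 = D4[THEN conjunct2]
  show "is_projection (P x)" if "x \<in> verts G"
    by (rule D[THEN conjunct1, THEN bspec, THEN conjunct1]) (rule that)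
  show "partial_isometry (S e)" if "e \<in> arcs G"
    by (rule D1[THEN conjunct1, THEN bspec, THEN conjunct1]) (rule that)
  show "P x \<circ> P y = (\<lambda>_. 0)" if "x \<in> verts G" "y \<in> verts G" "x \<noteq> y"
    by (rule D2[THEN conjunct1, THEN bspec, THEN bspec, THEN mp]) (rule that)+
  show "cadjoint (S e) \<circ> S f = (\<lambda>_. 0)" if "e \<in> arcs G" "f \<in> arcs G" "e \<noteq> f"
    by (rule D3[THEN conjunct1, THEN bspec, THEN bspec, THEN mp]) (rule that)+
  show "cadjoint (S e) \<circ> S e = P (tail G e)" if "e \<in> arcs G"
    by (rule D4[THEN conjunct1, THEN bspec]) (rule that)
  show "(\<lambda>e. S e (cadjoint (S e) h)) summable_on {e\<in>arcs G. head G e = x}" if "x \<in> verts G"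
    by (rule D5[THEN bspec, THEN conjunct1, THEN spec]) (rule that)
  show "op_le (\<lambda>h. \<Sum>\<^sub>\<infinity>e\<in>{e\<in>arcs G. head G e = x}. S e (cadjoint (S e) h)) (P x)"
    if "x \<in> verts G"
    by (rule D5[THEN bspec, THEN conjunct2]) (rule that)
qed

lemma S_bounded: "e \<in> arcs G \<Longrightarrow> bounded_clinear (S e)"
  using dagger_rules(2) unfolding partial_isometry_def by (rule conjunct1)

lemma P_bounded: "x \<in> verts G \<Longrightarrow> bounded_clinear (P x)"
  using dagger_rules(1) unfolding is_projection_def by (rule conjunct1)

lemma S_zero [simp]: "e \<in> arcs G \<Longrightarrow> S e 0 = 0"
  by (rule bounded_clinearD(4)[OF S_bounded])

lemma P_zero [simp]: "x \<in> verts G \<Longrightarrow> P x 0 = 0"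
  by (rule bounded_clinearD(4)[OF P_bounded])

lemma P_selfadjoint:
  assumes x: "x \<in> verts G"
  shows "cinner (P x h) k = cinner h (P x k)"
proof -
  have "cadjoint (P x) = P x"
    using dagger_rules(1)[OF x] by (simp add: is_projection_def)
  then show ?thesis using cinner_cadjoint_left[OF P_bounded[OF x], of h k] by simp
qed

lemma P_P:
  assumes x: "x \<in> verts G" and y: "y \<in> verts G"
  shows "P x (P y h) = (if x = y then P x h else 0)"
proof -
  have "P x \<circ> P x = P x" "x \<noteq> y \<longrightarrow> P x \<circ> P y = (\<lambda>_. 0)"
    using dagger_rules(1)[OF x] dagger_rules(3)[OF x y] by (simp_all add: is_projection_def)
  then show ?thesis by (cases "x = y") (auto simp: fun_eq_iff)
qed

lemma cadjoint_S_S: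
  assumes e: "e \<in> arcs G" and f: "f \<in> arcs G"
  shows "cadjoint (S e) (S f h) = (if e = f then P (tail G e) h else 0)"
proof -
  have "cadjoint (S e) \<circ> S e = P (tail G e)" "e \<noteq> f \<longrightarrow> cadjoint (S e) \<circ> S f = (\<lambda>_. 0)"
    using dagger_rules(5)[OF e] dagger_rules(4)[OF e f] by simp_all
  then show ?thesis by (cases "e = f") (auto simp: fun_eq_iff)
qed

lemma S_P_tail:
  assumes e: "e \<in> arcs G"
  shows "S e (P (tail G e) h) = S e h"
proof -
  note x = tail_verts[OF e]
  define k where "k = h - P (tail G e) h"
  have "cinner (S e k) (S e k) = cinner k (P (tail G e) k)"
    using cinner_cadjoint_right[OF S_bounded[OF e], of k "S e k"] cadjoint_S_S[OF e e] by simp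
  also have "P (tail G e) k = 0"
    using P_P[OF x x] by (simp add: k_def bounded_clinearD(3)[OF P_bounded[OF x]])
  finally have "cinner (S e k) (S e k) = 0" by simp
  then have "S e k = 0" by (simp only: cinner_self_eq_0)
  then show ?thesis by (simp add: k_def bounded_clinearD(3)[OF S_bounded[OF e]])
qed

text \<open>
  A vector \<open>h\<close> with \<open>P\<^sub>x h = 0\<close> is annihilated by \<open>S\<^sub>e\<^sup>*\<close> whenever \<open>e\<close> ends in \<open>x\<close>, because
  \<open>\<parallel>S\<^sub>e\<^sup>* h\<parallel>\<^sup>2\<close> is one of the terms of a sum dominated by \<open>\<parallel>P\<^sub>x h\<parallel>\<^sup>2\<close>.
\<close>

lemma cadjoint_S_eq_0:
  assumes f: "f \<in> arcs G" and h: "P (head G f) h = 0"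
  shows "cadjoint (S f) h = 0"
proof -
  define X where "X = {e\<in>arcs G. head G e = head G f}"
  define s where "s = (\<Sum>\<^sub>\<infinity>e\<in>X. S e (cadjoint (S e) h))"
  have "(\<lambda>e. S e (cadjoint (S e) h)) summable_on X"
    and pos: "positive_op (\<lambda>h. P (head G f) h - (\<Sum>\<^sub>\<infinity>e\<in>X. S e (cadjoint (S e) h)))"
    using dagger_rules(6,7)[OF head_verts[OF f]] by (simp_all add: X_def op_le_def)
  then have "((\<lambda>e. S e (cadjoint (S e) h)) has_sum s) X"
    unfolding s_def by (intro has_sum_infsum)
  then have "((\<lambda>e. Re (cinner h (S e (cadjoint (S e) h)))) has_sum Re (cinner h s)) X"
    by (rule has_sum_bounded_linear[OF bounded_linear_compose[OF bounded_linear_Re bounded_linear_cinner_right]])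
  moreover have "Re (cinner h (S e (cadjoint (S e) h))) = (norm (cadjoint (S e) h))\<^sup>2" if "e \<in> X" for e
  proof -
    have "e \<in> arcs G" using that by (simp add: X_def)
    from cinner_cadjoint_left[OF S_bounded[OF this], of h "cadjoint (S e) h"]
    show ?thesis by (subst (asm) cinner_self) (metis Re_complex_of_real)
  qed
  ultimately have sum: "((\<lambda>e. (norm (cadjoint (S e) h))\<^sup>2) has_sum Re (cinner h s)) X"
    by (simp cong: has_sum_cong)
  have "(\<Sum>e\<in>{f}. (norm (cadjoint (S e) h))\<^sup>2) \<le> Re (cinner h s)"
    by (rule finite_sum_le_has_sum[OF sum]) (use f in \<open>auto simp: X_def\<close>)
  then have "(norm (cadjoint (S f) h))\<^sup>2 \<le> Re (cinner h s)" by simp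
  moreover have "0 \<le> Re (cinner h (P (head G f) h - s))"
    using pos by (simp add: positive_op_def s_def)
  moreover have "Re (cinner h (P (head G f) h - s)) = - Re (cinner h s)"
    by (simp add: h cinner_minus_right)
  ultimately have "(norm (cadjoint (S f) h))\<^sup>2 \<le> 0" by linarith
  then show ?thesis by simp
qed

lemma P_S:
  assumes f: "f \<in> arcs G" and x: "x \<in> verts G"
  shows "P x (S f h) = (if head G f = x then S f h else 0)"
proof -
  note y = head_verts[OF f]
  have eq: "P (head G f) (S f h) = S f h"
  proof (rule cinner_extensionality)
    fix k
    have "cadjoint (S f) (k - P (head G f) k) = 0"
      by (rule cadjoint_S_eq_0[OF f]) (simp add: P_P[OF y y] bounded_clinearD(3)[OF P_bounded[OF y]])
    then have "cinner (k - P (head G f) k) (S f h) = 0"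
      using cinner_cadjoint_left[OF S_bounded[OF f], of "k - P (head G f) k" h] by simp
    then show "cinner k (P (head G f) (S f h)) = cinner k (S f h)"
      by (simp add: cinner_diff_left P_selfadjoint[OF y])
  qed
  show ?thesis
  proof (cases "head G f = x")
    case False
    then show ?thesis using P_P[OF x y, of "S f h"] by (simp add: eq)
  qed (use eq in auto)
qed

lemma P_word:
  assumes "v \<in> verts G" "P v u = u" "set w \<subseteq> arcs G" "x \<in> verts G"
  shows "P x (foldr S w u) = (if path_end G v w = x then foldr S w u else 0)"
proof (cases w)
  case Nil
  moreover have "P x u = (if x = v then u else 0)"
  proof (cases "x = v")
    case False
    then show ?thesis using P_P[OF assms(4,1), of u] by (simp add: assms(2))
  qed (simp add: assms(2))
  ultimately show ?thesis by simp
next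
  case (Cons e w')
  then show ?thesis using assms P_S by simp
qed

lemma word_eq_0:
  assumes "v \<in> verts G" "P v u = u" "set w \<subseteq> arcs G" "\<not> is_path G v w"
  shows "foldr S w u = 0"
  using assms(3,4)
proof (induction w)
  case (Cons e w)
  then have e: "e \<in> arcs G" by simp
  show ?case
  proof (cases "is_path G v w")
    case True
    then have "P (tail G e) (foldr S w u) = 0"
      using Cons.prems by (subst P_word[OF assms(1,2) _ tail_verts[OF e]]) auto
    then have "S e (foldr S w u) = S e 0" by (metis S_P_tail[OF e])
    then show ?thesis by (simp add: e)
  qed (use Cons in auto)
qed simp

text \<open>
  The two words are compared from their heads. Different letters give \<open>0\<close>; equal letters cancel up to
  a projection \<open>P\<^sub>x\<close>, which fixes or kills the rest of the word; and a word that ends before the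
  other one leaves a wandering vector, which the next letter of the other word annihilates.
\<close>

lemma word_gram:
  assumes T: "bounded_clinear T" and sa: "\<And>h k. cinner (T h) k = cinner h (T k)"
    and TP: "\<And>x h. x \<in> verts G \<Longrightarrow> T (P x h) = P x (T h)"
    and toeplitz: "\<And>e f h. e \<in> arcs G \<Longrightarrow> f \<in> arcs G \<Longrightarrow>
      cadjoint (S e) (T (S f h)) = (if e = f then T (P (tail G e) h) else 0)"
    and v: "v \<in> verts G" "P v u = u"
    and u: "\<And>e. e \<in> arcs G \<Longrightarrow> cadjoint (S e) (T u) = 0"
    and u': "\<And>e. e \<in> arcs G \<Longrightarrow> cadjoint (S e) (T u') = 0"
    and w: "set w \<subseteq> arcs G" "set w' \<subseteq> arcs G"
  shows "cinner (foldr S w u) (T (foldr S w' u')) =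
    (if w = w' \<and> is_path G v w then cinner u (T u') else 0)"
  using w
proof (induction w arbitrary: w')
  case Nil
  show ?case
  proof (cases w')
    case (Cons f ws)
    then have f: "f \<in> arcs G" using Nil by simp
    have "cinner u (T (S f k)) = 0" for k
      using cinner_cadjoint_left[OF S_bounded[OF f], of "T u" k] by (simp add: u[OF f] sa)
    then show ?thesis using Cons by simp
  qed simp
next
  case (Cons e w)
  then have e: "e \<in> arcs G" and w: "set w \<subseteq> arcs G" by auto
  define k where "k = foldr S w u"
  show ?case
  proof (cases w')
    case Nil
    have "cinner (S e k) (T u') = 0"
      using cinner_cadjoint_right[OF S_bounded[OF e], of k "T u'"] by (simp add: u'[OF e])
    then show ?thesis using Nil by (simp add: k_def)
  next
    case w': (Cons f ws)
    then have f: "f \<in> arcs G" and ws: "set ws \<subseteq> arcs G" using Cons.prems by auto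
    define k' where "k' = foldr S ws u'"
    have x: "tail G e \<in> verts G" by (rule tail_verts[OF e])
    have "cinner (S e k) (T (S f k')) = cinner k (cadjoint (S e) (T (S f k')))"
      by (simp add: cinner_cadjoint_right[OF S_bounded[OF e]])
    also have "\<dots> = (if e = f then cinner (P (tail G e) k) (T k') else 0)"
      using tail_verts[OF f] by (auto simp: toeplitz[OF e f] TP P_selfadjoint)
    also have "P (tail G e) k = (if path_end G v w = tail G e then k else 0)"
      unfolding k_def by (rule P_word[OF v w x])
    finally show ?thesis
      using Cons.IH[OF w ws] by (auto simp: w' k_def k'_def)
  qed
qed

text \<open>
  The vectors \<open>u\<close> are indexed by pairs \<open>(x, j)\<close>, where \<open>x\<close> is the vertex with \<open>P\<^sub>x\<close> fixing the vector.
  All pairs of an index and a word are admitted, so that applying \<open>S\<^sub>f\<close> is prepending \<open>f\<close> to the word;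
  the value at a word that is not a path is zero by itself.
\<close>

definition word_family :: "('v \<times> 'j) set \<Rightarrow> ('v \<times> 'j \<Rightarrow> 'h) \<Rightarrow> ('v \<times> 'j) \<times> 'e list \<Rightarrow> 'h" where
  "word_family I u = (\<lambda>(i, w). if i \<in> I \<and> set w \<subseteq> arcs G then foldr S w (u i) else 0)"

definition path_index :: "('v \<times> 'j) set \<Rightarrow> (('v \<times> 'j) \<times> 'e list) set" where
  "path_index I = {(i, w). i \<in> I \<and> set w \<subseteq> arcs G \<and> is_path G (fst i) w}"

lemma word_family_gram:
  assumes T: "bounded_clinear T" and sa: "\<And>h k. cinner (T h) k = cinner h (T k)"
    and TP: "\<And>x h. x \<in> verts G \<Longrightarrow> T (P x h) = P x (T h)"
    and toeplitz: "\<And>e f h. e \<in> arcs G \<Longrightarrow> f \<in> arcs G \<Longrightarrow>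
      cadjoint (S e) (T (S f h)) = (if e = f then T (P (tail G e) h) else 0)"
    and v: "\<And>i. i \<in> I \<Longrightarrow> fst i \<in> verts G" "\<And>i. i \<in> I \<Longrightarrow> P (fst i) (u i) = u i"
    and u: "\<And>i e. i \<in> I \<Longrightarrow> e \<in> arcs G \<Longrightarrow> cadjoint (S e) (T (u i)) = 0"
    and on: "\<And>i j. i \<in> I \<Longrightarrow> j \<in> I \<Longrightarrow> cinner (u i) (T (u j)) = (if i = j then 1 else 0)"
  shows "cinner (word_family I u p) (T (word_family I u q)) =
      (if p = q \<and> p \<in> path_index I then 1 else 0)"
proof -
  obtain i w j w' where p: "p = (i, w)" and q: "q = (j, w')" by fastforce
  show ?thesis
  proof (cases "i \<in> I \<and> set w \<subseteq> arcs G \<and> j \<in> I \<and> set w' \<subseteq> arcs G")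
    case True
    then show ?thesis
      using word_gram[OF T sa TP toeplitz v(1)[of i] v(2)[of i] u[of i] u[of j], of w w']
      by (auto simp: p q word_family_def path_index_def on)
  next
    case False
    then show ?thesis
      by (auto simp: p q word_family_def path_index_def bounded_clinearD(4)[OF T])
  qed
qed

lemma word_family_eq_0:
  assumes v: "\<And>i. i \<in> I \<Longrightarrow> fst i \<in> verts G" "\<And>i. i \<in> I \<Longrightarrow> P (fst i) (u i) = u i"
    and p: "p \<notin> path_index I"
  shows "word_family I u p = 0"
  using p word_eq_0[OF v] by (cases p) (auto simp: word_family_def path_index_def)

lemma S_word_family:
  "f \<in> arcs G \<Longrightarrow> S f (word_family I u (i, w)) = word_family I u (i, f # w)"
  by (simp add: word_family_def)

lemma P_word_family:
  assumes v: "\<And>i. i \<in> I \<Longrightarrow> fst i \<in> verts G" "\<And>i. i \<in> I \<Longrightarrow> P (fst i) (u i) = u i"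
    and x: "x \<in> verts G"
  shows "P x (word_family I u (i, w)) =
    (if path_end G (fst i) w = x then word_family I u (i, w) else 0)"
  using P_word[OF v _ x] x by (auto simp: word_family_def)

end

section \<open>Wandering vectors of a pure family\<close>

definition l2single :: "'i \<Rightarrow> 'a \<Rightarrow> ('i, 'a::complex_hilbert_space) l2sum" where
  "l2single i a = Abs_l2sum (\<lambda>j. if j = i then a else 0)"

lemma l2sum_nth_l2single: "l2sum_nth (l2single i a) j = (if j = i then a else 0)"
proof -
  have "square_summable (\<lambda>j. if j = i then a else 0)"
    unfolding square_summable_def
    by (rule finite_nonzero_values_imp_summable_on, rule finite_subset[of _ "{i}"]) auto
  then show ?thesis by (simp add: l2single_def l2sum_nth_Abs)
qed

lemma cinner_l2single: "cinner (l2single i a) \<psi> = cinner a (l2sum_nth \<psi> i)"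
proof -
  have "cinner (l2single i a) \<psi> = (\<Sum>\<^sub>\<infinity>j\<in>{i}. cinner (l2sum_nth (l2single i a) j) (l2sum_nth \<psi> j))"
    unfolding cinner_l2sum_def
    by (rule infsum_cong_neutral) (auto simp: l2sum_nth_l2single)
  then show ?thesis by (simp add: l2sum_nth_l2single)
qed

lemma closed_cspan_orthogonal_eq_0:
  assumes "x \<in> closed_cspan B" and "\<And>b. b \<in> B \<Longrightarrow> cinner b x = 0"
  shows "x = 0"
proof -
  define N where "N = {y. cinner y x = 0}"
  have "closed N"
    unfolding N_def
    by (intro closed_Collect_eq bounded_linear.continuous_on[OF bounded_linear_cinner_left]
        continuous_intros)
  moreover have "complex_vector.span B \<subseteq> N"
  proof (rule complex_vector.span_minimal)
    show "complex_vector.subspace N"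
      unfolding complex_vector.subspace_def
      by (simp add: N_def cinner_add_left cinner_scaleC_left)
  qed (use assms(2) in \<open>auto simp: N_def\<close>)
  ultimately have "closed_cspan B \<subseteq> N"
    unfolding closed_cspan_def by (rule closure_minimal[rotated])
  then have "cinner x x = 0" using assms(1) by (auto simp: N_def)
  then show ?thesis by (simp only: cinner_self_eq_0)
qed

context dagger_graph
begin

text \<open>
  In the model, the wandering vectors are spanned by the basis vectors at the paths of length zero, one
  for each summand; applying words to them produces the whole basis.
\<close>

lemma pure_family_wandering_basis:
  assumes sinks: "no_sinks G" and pure: "pure_family G S"
  obtains I :: "('v \<times> 'h) set" and b :: "'v \<times> 'h \<Rightarrow> 'h"
  where "\<And>i. i \<in> I \<Longrightarrow> fst i \<in> verts G" "\<And>i. i \<in> I \<Longrightarrow> P (fst i) (b i) = b i"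
    and "\<And>i e. i \<in> I \<Longrightarrow> e \<in> arcs G \<Longrightarrow> cadjoint (S e) (b i) = 0"
    and "\<And>i j. i \<in> I \<Longrightarrow> j \<in> I \<Longrightarrow> cinner (b i) (b j) = (if i = j then 1 else 0)"
    and "\<And>h. (\<And>i w. i \<in> I \<Longrightarrow> set w \<subseteq> arcs G \<Longrightarrow> cinner (foldr S w (b i)) h = 0) \<Longrightarrow> h = 0"
proof -
  interpret wf_digraph G by (rule wf)
  obtain J :: "'v \<Rightarrow> 'h set" and U :: "'h \<Rightarrow> ('v \<times> 'h, ('v \<times> 'e list, complex) l2sum) l2sum"
    where U: "unitary_onto U (pure_model_space G J)"
    and US': "\<And>e \<psi>. e \<in> arcs G \<Longrightarrow> \<psi> \<in> pure_model_space G J \<Longrightarrow>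
      U (S e (cadjoint U \<psi>)) = op_ampliation (L_op G e) \<psi>"
    using pure unfolding pure_family_def by blast
  have Ub: "bounded_clinear U" and ran: "range U = pure_model_space G J"
    and Uc: "\<And>x y. cinner (U x) (U y) = cinner x y"
    using U by (auto simp: unitary_onto_def)
  have UU: "cadjoint U (U h) = h" for h
    by (rule cinner_extensionality) (simp add: cinner_cadjoint_right[OF Ub] Uc)
  have US: "U (S e h) = op_ampliation (L_op G e) (U h)" if "e \<in> arcs G" for e h
    using US'[OF that, of "U h"] ran by (auto simp: UU)
  define I where "I = {i. fst i \<in> verts G \<and> snd i \<in> J (fst i)}"
  define \<epsilon> :: "'v \<times> 'h \<Rightarrow> 'v \<times> 'e list \<Rightarrow> ('v \<times> 'h, ('v \<times> 'e list, complex) l2sum) l2sum"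
    where "\<epsilon> = (\<lambda>i w. l2single i (l2basis w))"
  have c\<epsilon>: "cinner (\<epsilon> i w) \<psi> = l2sum_nth (l2sum_nth \<psi> i) w" for i w \<psi>
    by (simp add: \<epsilon>_def cinner_l2single cinner_l2basis)
  have \<epsilon>M: "\<epsilon> i (fst i, p) \<in> pure_model_space G J"
    if "i \<in> I" "(fst i, p) \<in> free_semigroupoid G" for i p
  proof -
    have "l2basis (fst i, p) \<in> H_sub G (fst i)"
      unfolding H_sub_def closed_cspan_def
      by (rule subsetD[OF closure_subset], rule complex_vector.span_base) (use that in auto)
    moreover have "0 \<in> H_sub G x" for x
      unfolding H_sub_def closed_cspan_def
      by (rule subsetD[OF closure_subset], rule complex_vector.span_zero)
    ultimately show ?thesis
      using that(1) by (auto simp: pure_model_space_def subspace_dsum_def \<epsilon>_def l2sum_nth_l2single I_def)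
  qed
  have fs: "(x, p) \<in> free_semigroupoid G" if "awalk x p y" for x p y
    using that by (auto simp: free_semigroupoid_def)
  have nil: "awalk x [] x" if "x \<in> verts G" for x
    using that by (simp add: awalk_Nil_iff)
  have IV: "fst i \<in> verts G" if "i \<in> I" for i using that by (auto simp: I_def)
  define b where "b = (\<lambda>i. cadjoint U (\<epsilon> i (fst i, [])))"
  have Ub0: "U (b i) = \<epsilon> i (fst i, [])" if "i \<in> I" for i
  proof -
    have "\<epsilon> i (fst i, []) \<in> range U"
      unfolding ran by (rule \<epsilon>M[OF that fs[OF nil[OF IV[OF that]]]])
    then show ?thesis by (auto simp: b_def UU)
  qed
  have Uw: "U (foldr S (rev p) (b i)) = \<epsilon> i (fst i, p)" if "i \<in> I" "awalk (fst i) p y" for i p y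
    using that(2)
  proof (induction p arbitrary: y rule: rev_induct)
    case Nil
    then show ?case by (simp add: Ub0[OF that(1)])
  next
    case (snoc f p)
    then have p: "awalk (fst i) p (tail G f)" and f: "f \<in> arcs G"
      unfolding awalk_append_arc_iff[OF wf] by blast+
    have "op_ampliation (L_op G f) (\<epsilon> i (fst i, p)) = \<epsilon> i (fst i, p @ [f])"
    proof (rule l2sum_eqI)
      fix k
      show "l2sum_nth (op_ampliation (L_op G f) (\<epsilon> i (fst i, p))) k = l2sum_nth (\<epsilon> i (fst i, p @ [f])) k"
        using L_op_l2basis[OF wf f fs[OF p]] path_range_eq[OF wf p]
        by (simp add: l2sum_nth_op_ampliation[OF bounded_clinear_L_op] \<epsilon>_def l2sum_nth_l2single
            bounded_clinearD(4)[OF bounded_clinear_L_op])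
    qed
    then show ?case using snoc.IH[OF p] by (simp add: US[OF f])
  qed
  have on: "cinner (b i) (b j) = (if i = j then 1 else 0)" if "i \<in> I" "j \<in> I" for i j
    using Uc[of "b i" "b j"]
    by (simp add: Ub0 that c\<epsilon>) (auto simp: \<epsilon>_def l2sum_nth_l2single l2sum_nth_l2basis)
  show thesis
  proof (rule that[of I b])
    fix i e assume i: "i \<in> I" and e: "e \<in> arcs G"
    show "cadjoint (S e) (b i) = 0"
    proof (rule cinner_extensionality)
      fix k
      have "cinner (b i) (S e k) = cinner (\<epsilon> i (fst i, [])) (U (S e k))"
        by (simp add: Ub0[OF i, symmetric] Uc)
      also have "\<dots> = 0"
        by (simp add: c\<epsilon> US[OF e] l2sum_nth_op_ampliation[OF bounded_clinear_L_op] l2sum_nth_L_op)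
      finally have "cinner (S e k) (b i) = 0" by (subst cinner_eq_0_commute)
      then show "cinner k (cadjoint (S e) (b i)) = cinner k 0"
        by (simp add: cinner_cadjoint_right[OF S_bounded[OF e]])
    qed
  next
    fix i assume i: "i \<in> I"
    show x: "fst i \<in> verts G" by (rule IV[OF i])
    then obtain e where e: "e \<in> arcs G" and tail: "tail G e = fst i"
      using sinks unfolding no_sinks_def by blast
    \<comment> \<open>\<open>S\<^sub>e b\<^sub>i\<close> is the basis vector at the path \<open>e\<close>, so the projection \<open>S\<^sub>e\<^sup>* S\<^sub>e\<close> preserves the norm of \<open>b\<^sub>i\<close>\<close>
    have "awalk (fst i) [e] (head G e)"
      using e tail by (metis arc_implies_awalk)
    from Uw[OF i this] have "U (S e (b i)) = \<epsilon> i (fst i, [e])" by simp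
    then have "cinner (S e (b i)) (S e (b i)) = 1"
      using Uc[of "S e (b i)" "S e (b i)"]
      by (simp add: c\<epsilon>) (simp add: \<epsilon>_def l2sum_nth_l2single l2sum_nth_l2basis)
    then have 1: "cinner (b i) (P (fst i) (b i)) = 1"
      using cinner_cadjoint_right[OF S_bounded[OF e], of "b i" "S e (b i)"]
      by (simp add: cadjoint_S_S[OF e e] tail)
    then have "cinner (P (fst i) (b i)) (b i) = 1" "cinner (P (fst i) (b i)) (P (fst i) (b i)) = 1"
      by (simp_all add: P_selfadjoint[OF x] P_P[OF x x])
    with 1 have "cinner (b i - P (fst i) (b i)) (b i - P (fst i) (b i)) = 0"
      using on[OF i i] by (simp add: cinner_diff_left cinner_diff_right)
    then have "b i - P (fst i) (b i) = 0" by (simp only: cinner_self_eq_0)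
    then show "P (fst i) (b i) = b i" by simp
  next
    fix h assume h: "\<And>i w. i \<in> I \<Longrightarrow> set w \<subseteq> arcs G \<Longrightarrow> cinner (foldr S w (b i)) h = 0"
    have "U h \<in> pure_model_space G J" using ran by blast
    then have "l2sum_nth (U h) i \<in> (case i of (x, j) \<Rightarrow> if x \<in> verts G \<and> j \<in> J x then H_sub G x else {0})" for i
      unfolding pure_model_space_def subspace_dsum_def by blast
    then have mem: "l2sum_nth (U h) i \<in> (if i \<in> I then H_sub G (fst i) else {0})" for i
      by (simp add: I_def case_prod_unfold)
    have "l2sum_nth (U h) i = 0" for i
    proof (cases "i \<in> I")
      case True
      then have "l2sum_nth (U h) i \<in> closed_cspan {l2basis w |w. w \<in> free_semigroupoid G \<and> fst w = fst i}"
        using mem[of i] by (simp add: H_sub_def)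
      then show ?thesis
      proof (rule closed_cspan_orthogonal_eq_0)
        fix a :: "('v \<times> 'e list, complex) l2sum"
        assume "a \<in> {l2basis w |w. w \<in> free_semigroupoid G \<and> fst w = fst i}"
        then obtain p y where a: "a = l2basis (fst i, p)" and p: "awalk (fst i) p y"
          by (auto simp: free_semigroupoid_def)
        from p have "set p \<subseteq> arcs G" by auto
        then have "cinner (\<epsilon> i (fst i, p)) (U h) = 0"
          unfolding Uw[OF True p, symmetric] Uc by (intro h True) simp
        then show "cinner a (l2sum_nth (U h) i) = 0"
          by (simp add: a c\<epsilon> cinner_l2basis)
      qed
    qed (use mem[of i] in simp)
    then have "U h = 0" by (intro l2sum_eqI) simp
    then show "h = 0" using UU[of h] bounded_clinearD(4)[OF bounded_clinear_cadjoint[OF Ub]] by simp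
  qed (fact on)
qed

end

section \<open>Factorisation of Toeplitz operators\<close>

context dagger_graph
begin

lemma gram_of_commuting_toeplitz:
  assumes A: "bounded_clinear A" and AP: "\<And>x h. x \<in> verts G \<Longrightarrow> A (P x h) = P x (A h)"
    and AS: "\<And>e h. e \<in> arcs G \<Longrightarrow> A (S e h) = S e (A h)"
  shows "x \<in> verts G \<Longrightarrow> cadjoint A (A (P x h)) = P x (cadjoint A (A h))"
    and "e \<in> arcs G \<Longrightarrow> f \<in> arcs G \<Longrightarrow> cadjoint (S e) (cadjoint A (A (S f h))) =
      (if e = f then cadjoint A (A (P (tail G e) h)) else 0)"
proof -
  show "cadjoint A (A (P x h)) = P x (cadjoint A (A h))" if x: "x \<in> verts G"
    by (rule cinner_extensionality)
       (simp add: cinner_cadjoint_right[OF A] P_selfadjoint[OF x, symmetric] AP[OF x])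
  show "cadjoint (S e) (cadjoint A (A (S f h))) =
      (if e = f then cadjoint A (A (P (tail G e) h)) else 0)"
    if e: "e \<in> arcs G" and f: "f \<in> arcs G"
  proof (rule cinner_extensionality)
    fix k
    have "cinner k (cadjoint (S e) (cadjoint A (A (S f h)))) = cinner (S e (A k)) (S f (A h))"
      by (simp add: cinner_cadjoint_right[OF A] cinner_cadjoint_right[OF S_bounded[OF e]] AS e f)
    also have "\<dots> = cinner (A k) (cadjoint (S e) (S f (A h)))"
      by (simp add: cinner_cadjoint_right[OF S_bounded[OF e]])
    also have "\<dots> = cinner k (if e = f then cadjoint A (A (P (tail G e) h)) else 0)"
      by (simp add: cadjoint_S_S[OF e f] cinner_cadjoint_right[OF A] AP[OF tail_verts[OF e]]
          del: if_image_distrib)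
         (simp add: cinner_cadjoint_right[OF A] AP[OF tail_verts[OF f]])
    finally show "cinner k (cadjoint (S e) (cadjoint A (A (S f h)))) =
      cinner k (if e = f then cadjoint A (A (P (tail G e) h)) else 0)" .
  qed
qed

text \<open>
  The projection onto the wandering vectors \<open>\<Inter>\<^sub>e ker S\<^sub>e\<^sup>*\<close> is \<open>V\<^sup>* V\<close> for the analysis operator of an
  orthonormal basis of them.
\<close>

lemma wandering_projection:
  fixes I :: "('v \<times> 'j) set" and b :: "'v \<times> 'j \<Rightarrow> 'h"
  assumes wander: "\<And>i e. i \<in> I \<Longrightarrow> e \<in> arcs G \<Longrightarrow> cadjoint (S e) (b i) = 0"
    and on: "\<And>i j. i \<in> I \<Longrightarrow> j \<in> I \<Longrightarrow> cinner (b i) (b j) = (if i = j then 1 else 0)"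
    and total: "\<And>h. (\<And>i w. i \<in> I \<Longrightarrow> set w \<subseteq> arcs G \<Longrightarrow> cinner (foldr S w (b i)) h = 0) \<Longrightarrow> h = 0"
  obtains E where "bounded_clinear E" "\<And>h k. cinner (E h) k = cinner h (E k)"
    "\<And>e h. e \<in> arcs G \<Longrightarrow> cadjoint (S e) (E h) = 0"
    "\<And>g. (\<And>e. e \<in> arcs G \<Longrightarrow> cadjoint (S e) g = 0) \<Longrightarrow> E g = g"
    "\<And>x h. x \<in> verts G \<Longrightarrow> E (P x h) = P x (E h)"
proof -
  define b' where "b' = (\<lambda>i. if i \<in> I then b i else 0)"
  have "cinner (b' i) (b' j) = (if i = j \<and> i \<in> I then 1 else 0)" for i j
    by (auto simp: b'_def on)
  from analysis_operator[OF bounded_clinear_id refl Re_cinner_self_nonneg this]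
  obtain V :: "'h \<Rightarrow> ('v \<times> 'j, complex) l2sum" where V: "bounded_clinear V"
    and Vn: "\<And>h i. l2sum_nth (V h) i = cinner (b' i) h" by blast
  define E where "E = (\<lambda>h. cadjoint V (V h))"
  have lin: "bounded_clinear E"
    unfolding E_def by (rule bounded_clinear_compose[OF bounded_clinear_cadjoint[OF V] V])
  have EV: "cinner k (E h) = cinner (V k) (V h)" for h k
    by (simp add: E_def cinner_cadjoint_right[OF V])
  have sa: "cinner (E h) k = cinner h (E k)" for h k
    using EV[of h k] cinner_cadjoint_left[OF V, of "V h" k] by (simp add: E_def)
  have bE: "cinner (b i) (E h) = cinner (b i) h" if "i \<in> I" for i h
  proof -
    have "V (b i) = l2basis i"
      by (rule l2sum_eqI) (use that in \<open>auto simp: Vn b'_def on l2sum_nth_l2basis\<close>)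
    then show ?thesis using that by (simp add: EV cinner_l2basis Vn b'_def)
  qed
  have SE: "cadjoint (S e) (E h) = 0" if e: "e \<in> arcs G" for e h
  proof (rule cinner_extensionality)
    fix k
    have "cinner (b i) (S e k) = 0" if "i \<in> I" for i
      using cinner_cadjoint_left[OF S_bounded[OF e], of "b i" k] wander[OF that e] by simp
    then have "V (S e k) = 0" by (intro l2sum_eqI) (simp add: Vn b'_def)
    then show "cinner k (cadjoint (S e) (E h)) = cinner k 0"
      by (simp add: cinner_cadjoint_right[OF S_bounded[OF e]] EV)
  qed
  have Eid: "E g = g" if g: "\<And>e. e \<in> arcs G \<Longrightarrow> cadjoint (S e) g = 0" for g
  proof -
    have "E g - g = 0"
    proof (rule total)
      fix i w assume i: "i \<in> I" and w: "set w \<subseteq> arcs G"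
      show "cinner (foldr S w (b i)) (E g - g) = 0"
      proof (cases w)
        case Nil
        then show ?thesis by (simp add: cinner_diff_right bE[OF i])
      next
        case (Cons e ws)
        then have e: "e \<in> arcs G" using w by simp
        have "cadjoint (S e) (E g - g) = 0"
          by (simp add: bounded_clinearD(3)[OF bounded_clinear_cadjoint[OF S_bounded[OF e]]] SE[OF e] g[OF e])
        then show ?thesis
          using Cons cinner_cadjoint_right[OF S_bounded[OF e], of "foldr S ws (b i)" "E g - g"] by simp
      qed
    qed
    then show ?thesis by simp
  qed
  have EPE: "E (P x (E h)) = P x (E h)" if x: "x \<in> verts G" for x h
  proof (rule Eid, rule cinner_extensionality)
    fix e k assume e: "e \<in> arcs G"
    have "cinner (S e k) (E h) = 0"
      using cinner_cadjoint_right[OF S_bounded[OF e], of k "E h"] SE[OF e] by simp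
    then show "cinner k (cadjoint (S e) (P x (E h))) = cinner k 0"
      by (simp add: cinner_cadjoint_right[OF S_bounded[OF e]] P_selfadjoint[OF x, symmetric] P_S[OF e x])
  qed
  have EP: "E (P x h) = P x (E h)" if x: "x \<in> verts G" for x h
  proof -
    have "E (P x (E h)) = E (P x h)"
    proof (rule cinner_extensionality)
      fix k
      have "cinner k (E (P x h)) = cinner (P x (E k)) h"
        by (simp add: sa P_selfadjoint[OF x])
      also have "\<dots> = cinner (E (P x (E k))) h" by (simp only: EPE[OF x])
      also have "\<dots> = cinner k (E (P x (E h)))" by (simp add: sa P_selfadjoint[OF x])
      finally show "cinner k (E (P x (E h))) = cinner k (E (P x h))" by simp
    qed
    then show ?thesis by (simp only: EPE[OF x])
  qed
  show thesis by (rule that[OF lin sa SE Eid EP])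
qed

text \<open>
  The isometry from the inner product of \<open>Y\<close> to the given one has to map the wandering vectors of the
  former, that is \<open>Y\<^sup>-\<^sup>1 E\<close>, to the wandering vectors \<open>E\<close> of the latter. On \<open>Y\<^sup>-\<^sup>1 E\<close> the new inner
  product is that of the compression of \<open>Y\<^sup>-\<^sup>1\<close> to \<open>E\<close>: the map \<open>Y\<^sup>-\<^sup>1 g \<mapsto> C g\<close> is isometric for a
  square root \<open>C\<close> of the compression, and it is carried along the words by the Gram matrices.
\<close>

lemma toeplitz_factorisation:
  fixes Y :: "'h \<Rightarrow> 'h"
  assumes sinks: "no_sinks G" and pure: "pure_family G S"
    and pos: "positive_op Y" and inv: "invertible_op Y"
    and YP: "\<And>x h. x \<in> verts G \<Longrightarrow> Y (P x h) = P x (Y h)"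
    and toeplitz: "\<And>e f h. e \<in> arcs G \<Longrightarrow> f \<in> arcs G \<Longrightarrow>
      cadjoint (S e) (Y (S f h)) = (if e = f then Y (P (tail G e) h) else 0)"
  shows "\<exists>A. bounded_clinear A \<and> cadjoint A \<circ> A = Y \<and>
    (\<forall>x\<in>verts G. A \<circ> P x = P x \<circ> A) \<and> (\<forall>e\<in>arcs G. A \<circ> S e = S e \<circ> A)"
proof (rule pure_family_wandering_basis[OF sinks pure])
  fix I :: "('v \<times> 'h) set" and b :: "'v \<times> 'h \<Rightarrow> 'h"
  assume vx: "\<And>i. i \<in> I \<Longrightarrow> fst i \<in> verts G" and Pb: "\<And>i. i \<in> I \<Longrightarrow> P (fst i) (b i) = b i"
      and Sb: "\<And>i e. i \<in> I \<Longrightarrow> e \<in> arcs G \<Longrightarrow> cadjoint (S e) (b i) = 0"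
      and on: "\<And>i j. i \<in> I \<Longrightarrow> j \<in> I \<Longrightarrow> cinner (b i) (b j) = (if i = j then 1 else 0)"
      and total: "\<And>h. (\<And>i w. i \<in> I \<Longrightarrow> set w \<subseteq> arcs G \<Longrightarrow> cinner (foldr S w (b i)) h = 0) \<Longrightarrow> h = 0"
  obtain E where E: "bounded_clinear E" and Esa: "\<And>h k. cinner (E h) k = cinner h (E k)"
    and SE: "\<And>e h. e \<in> arcs G \<Longrightarrow> cadjoint (S e) (E h) = 0"
    and Eid: "\<And>g. (\<And>e. e \<in> arcs G \<Longrightarrow> cadjoint (S e) g = 0) \<Longrightarrow> E g = g"
    and EP: "\<And>x h. x \<in> verts G \<Longrightarrow> E (P x h) = P x (E h)"
    using wandering_projection[OF Sb on total] by blast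
  have EE: "E (E h) = E h" for h by (rule Eid) (rule SE)
  have Y: "bounded_clinear Y" using pos by (simp add: positive_op_def)
  have Ysa: "cinner (Y h) k = cinner h (Y k)" for h k by (rule positive_op_selfadjoint[OF pos])
  have Ypos: "0 \<le> Re (cinner h (Y h))" for h using pos by (simp add: positive_op_def)
  obtain R where R: "bounded_clinear R" and RY': "R \<circ> Y = id" and YR': "Y \<circ> R = id"
    using inv unfolding invertible_op_def by blast
  have RY: "R (Y h) = h" and YR: "Y (R h) = h" for h
    using fun_cong[OF RY', of h] fun_cong[OF YR', of h] by simp_all
  have Rsa: "cinner (R h) k = cinner h (R k)" for h k
    using Ysa[of "R h" "R k"] by (simp add: YR)
  have RP: "R (P x h) = P x (R h)" if "x \<in> verts G" for x h
    using arg_cong[OF YP[OF that, of "R h"], of R] by (simp add: RY YR)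
  obtain M where M: "0 < M" and "\<And>h. (norm (Y h))\<^sup>2 \<le> M * Re (cinner h (Y h))"
    using positive_op_lower_bound[OF pos] by blast
  from this(2)[of "R _"] have Rlow: "(norm h)\<^sup>2 / M \<le> Re (cinner h (R h))" for h
    using M by (simp add: YR Rsa field_simps)

  \<comment> \<open>the compression of \<open>Y\<^sup>-\<^sup>1\<close> to the range of \<open>E\<close>, extended by the identity on the complement so as
      to be bounded below on the whole space\<close>
  define Z where "Z = (\<lambda>h. E (R (E h)) + (h - E h))"
  define \<delta> where "\<delta> = min (1 / M) 1"
  have \<delta>: "0 < \<delta>" "\<delta> \<le> 1 / M" "\<delta> \<le> 1" using M by (simp_all add: \<delta>_def)
  have Z: "bounded_clinear Z"
    unfolding Z_def
    by (rule bounded_clinear_add[OF bounded_clinear_compose[OF E bounded_clinear_compose[OF R E]]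
          bounded_clinear_diff[OF bounded_clinear_id E]])
  have Zsa: "cinner (Z h) k = cinner h (Z k)" for h k
    by (simp add: Z_def cinner_add_left cinner_add_right cinner_diff_left cinner_diff_right Esa Rsa)
  have Zlow: "\<delta> * (norm h)\<^sup>2 \<le> Re (cinner h (Z h))" for h
  proof -
    have orth: "cinner (E h) (h - E h) = 0"
      by (simp add: cinner_diff_right Esa EE)
    have "(norm h)\<^sup>2 = (norm (E h))\<^sup>2 + (norm (h - E h))\<^sup>2"
      using norm_add_square[of "E h" "h - E h"] orth by simp
    then have "\<delta> * (norm h)\<^sup>2 = \<delta> * (norm (E h))\<^sup>2 + \<delta> * (norm (h - E h))\<^sup>2"
      by (simp add: algebra_simps)
    also have "\<dots> \<le> 1 / M * (norm (E h))\<^sup>2 + 1 * (norm (h - E h))\<^sup>2"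
      using \<delta> by (intro add_mono mult_right_mono) simp_all
    also have "\<dots> \<le> Re (cinner (E h) (R (E h))) + Re (cinner (h - E h) (h - E h))"
      using Rlow[of "E h"] by (simp add: cinner_self del: of_real_power)
    also have "\<dots> = Re (cinner h (Z h))"
      using orth by (simp add: Z_def cinner_add_right cinner_diff_left Esa)
    finally show ?thesis .
  qed
  obtain C where C: "bounded_clinear C" and Csa: "\<And>h k. cinner (C h) k = cinner h (C k)"
    and CC: "\<And>h. C (C h) = Z h" and bij: "bij C"
    and Ccomm: "\<And>K h. bounded_clinear K \<Longrightarrow> (\<And>h. K (Z h) = Z (K h)) \<Longrightarrow> K (C h) = C (K h)"
    using selfadjoint_sqrt[OF Z Zsa \<delta>(1) Zlow] by blast
  have CE: "E (C h) = C (E h)" for h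
    by (rule Ccomm[OF E]) (simp add: Z_def bounded_clinearD(2,3)[OF E] EE)
  have CP: "P x (C h) = C (P x h)" if x: "x \<in> verts G" for x h
    by (rule Ccomm[OF P_bounded[OF x]])
       (simp add: Z_def bounded_clinearD(2,3)[OF P_bounded[OF x]] EP[OF x] RP[OF x])
  have Cinj: "h = k" if "C h = C k" for h k using bij that by (simp add: bij_def inj_eq)

  define d where "d = (\<lambda>i. inv C (b i))"
  have Cd: "C (d i) = b i" for i unfolding d_def using bij by (simp add: bij_def surj_f_inv_f)
  have Ed: "E (d i) = d i" if i: "i \<in> I" for i
    by (rule Cinj) (simp add: CE[symmetric] Cd Eid[OF Sb[OF i]])
  have Pd: "P (fst i) (d i) = d i" if i: "i \<in> I" for i
    by (rule Cinj) (simp add: CP[OF vx[OF i], symmetric] Cd Pb[OF i])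
  define u where "u = (\<lambda>i. R (d i))"
  have Yu: "Y (u i) = d i" for i by (simp add: u_def YR)
  have Pu: "P (fst i) (u i) = u i" if i: "i \<in> I" for i
    by (simp add: u_def RP[OF vx[OF i], symmetric] Pd[OF i])
  have SYu: "cadjoint (S e) (Y (u i)) = 0" if "i \<in> I" "e \<in> arcs G" for i e
    using SE[OF that(2), of "d i"] by (simp add: Yu Ed[OF that(1)])
  have onu: "cinner (u i) (Y (u j)) = (if i = j then 1 else 0)" if i: "i \<in> I" and j: "j \<in> I" for i j
  proof -
    have "cinner (u i) (Y (u j)) = cinner (E (d i)) (R (E (d j)))"
      by (simp add: Yu Ed[OF i] Ed[OF j]) (simp add: u_def Rsa)
    also have "\<dots> = cinner (d i) (Z (d j))"
      by (simp add: Esa Z_def Ed[OF j])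
    also have "\<dots> = cinner (b i) (b j)"
      by (simp add: CC[symmetric] Csa[symmetric] Cd)
    finally show ?thesis by (simp add: on[OF i j])
  qed

  \<comment> \<open>the \<open>d\<^sub>i = C\<^sup>-\<^sup>1 b\<^sub>i\<close> are total in the wandering space, because \<open>E h = C (E k)\<close> turns
      orthogonality of \<open>h\<close> to \<open>d\<^sub>i\<close> into orthogonality of \<open>E k\<close> to \<open>b\<^sub>i\<close>\<close>
  have perp: "cinner g h = 0"
    if h: "\<And>i. i \<in> I \<Longrightarrow> cinner (d i) h = 0" and g: "\<And>e. e \<in> arcs G \<Longrightarrow> cadjoint (S e) g = 0" for g h
  proof -
    obtain k where k: "E h = C k" using bij by (metis bij_pointE)
    have Ck: "C (E k) = E h" by (simp add: CE[symmetric] k[symmetric] EE)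
    have "E k = 0"
    proof (rule total)
      fix i w assume i: "i \<in> I" and w: "set w \<subseteq> arcs G"
      show "cinner (foldr S w (b i)) (E k) = 0"
      proof (cases w)
        case Nil
        have "cinner (b i) (E k) = cinner (d i) (E h)"
          by (simp only: Cd[symmetric] Csa Ck)
        also have "\<dots> = cinner (d i) h" by (simp add: Esa[symmetric] Ed[OF i])
        finally show ?thesis using Nil h[OF i] by simp
      next
        case (Cons e ws)
        then have e: "e \<in> arcs G" using w by simp
        show ?thesis
          using Cons cinner_cadjoint_right[OF S_bounded[OF e], of "foldr S ws (b i)" "E k"] SE[OF e]
          by simp
      qed
    qed
    then have "E h = 0" using Ck bounded_clinearD(4)[OF C] by simp
    then show ?thesis using Esa[of g h] Eid[OF g] by simp
  qed
  \<comment> \<open>\<open>S\<^sub>f g - Y S\<^sub>f Y\<^sup>-\<^sup>1 g\<close> is wandering, so the two adjoints of \<open>S\<^sub>f\<close> agree on vectors orthogonal to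
      all wandering vectors\<close>
  have adj: "cadjoint (S f) h = R (cadjoint (S f) (Y h))"
    if h: "\<And>i. i \<in> I \<Longrightarrow> cinner (d i) h = 0" and f: "f \<in> arcs G" for f h
  proof (rule cinner_extensionality)
    fix g
    have "cinner (S f g - Y (S f (R g))) h = 0"
    proof (rule perp[OF h])
      fix e assume e: "e \<in> arcs G"
      note x = tail_verts[OF e]
      show "cadjoint (S e) (S f g - Y (S f (R g))) = 0"
        by (simp add: bounded_clinearD(3)[OF bounded_clinear_cadjoint[OF S_bounded[OF e]]]
            cadjoint_S_S[OF e f] toeplitz[OF e f] YP[OF x] YP[OF tail_verts[OF f]] YR)
    qed
    then show "cinner g (cadjoint (S f) h) = cinner g (R (cadjoint (S f) (Y h)))"
      by (simp add: cinner_diff_left cinner_cadjoint_right[OF S_bounded[OF f]] Rsa[symmetric] Ysa)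
  qed
  have vanish: "cinner (foldr S w (b i)) h = 0"
    if "i \<in> I" "set w \<subseteq> arcs G"
      and "\<And>i w. i \<in> I \<Longrightarrow> set w \<subseteq> arcs G \<Longrightarrow> cinner (foldr S w (u i)) (Y h) = 0" for i w h
    using that(2,3)
  proof (induction w arbitrary: h)
    case Nil
    have "cinner (d i) h = 0" if "i \<in> I" for i
      using Nil(2)[OF that, of "[]"] by (simp add: Yu flip: Ysa)
    then show ?case using perp[of h "b i"] Sb[OF that(1)] by simp
  next
    case (Cons f w)
    then have f: "f \<in> arcs G" and w: "set w \<subseteq> arcs G" by auto
    have dh: "cinner (d i) h = 0" if "i \<in> I" for i
      using Cons.prems(2)[OF that, of "[]"] by (simp add: Yu flip: Ysa)
    have "cinner (foldr S w (b i)) (cadjoint (S f) h) = 0"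
    proof (rule Cons.IH[OF w])
      fix j v assume j: "j \<in> I" and v: "set v \<subseteq> arcs G"
      show "cinner (foldr S v (u j)) (Y (cadjoint (S f) h)) = 0"
        using Cons.prems(2)[OF j, of "f # v"] f v
        by (simp add: adj[OF dh f] YR cinner_cadjoint_right[OF S_bounded[OF f]])
    qed
    then show ?case by (simp add: cinner_cadjoint_right[OF S_bounded[OF f]])
  qed

  define a where "a = word_family I u"
  define e where "e = word_family I b"
  have total_a: "h = 0" if "\<And>p. cinner (a p) h = 0" for h
  proof -
    have "cinner (foldr S w (u i)) (Y (R h)) = 0" if "i \<in> I" "set w \<subseteq> arcs G" for i w
      using \<open>\<And>p. cinner (a p) h = 0\<close>[of "(i, w)"] that by (simp add: a_def word_family_def YR)
    then have "R h = 0" by (intro total vanish)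
    then show ?thesis using YR[of h] bounded_clinearD(4)[OF Y] by simp
  qed
  have total_e: "h = 0" if "\<And>p. cinner (e p) h = 0" for h
  proof (rule total)
    fix i w assume "i \<in> I" "set w \<subseteq> arcs G"
    then show "cinner (foldr S w (b i)) h = 0"
      using that[of "(i, w)"] by (simp add: e_def word_family_def)
  qed
  have "\<exists>A. bounded_clinear A \<and> cadjoint A \<circ> A = Y \<and> (\<forall>p. A (a p) = e p)"
  proof (rule factorisation_of_gram[OF Y Ysa Ypos _ _ _ total_a total_e])
    show "cinner (a p) (Y (a q)) = (if p = q \<and> p \<in> path_index I then 1 else 0)" for p q
      unfolding a_def by (rule word_family_gram[OF Y Ysa YP toeplitz vx Pu SYu onu])
    show "cinner (e p) (e q) = (if p = q \<and> p \<in> path_index I then 1 else 0)" for p q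
      unfolding e_def
      by (rule word_family_gram[OF bounded_clinear_id refl refl cadjoint_S_S vx Pb Sb on])
    show "a p = 0" if "p \<notin> path_index I" for p
      unfolding a_def by (rule word_family_eq_0[OF vx Pu that])
  qed
  then obtain A where A: "bounded_clinear A" and AA: "cadjoint A \<circ> A = Y"
    and Aa: "\<And>p. A (a p) = e p" by blast
  have "A \<circ> P x = P x \<circ> A" if x: "x \<in> verts G" for x
  proof (rule bounded_clinear_eq_on_total[where a = a and I = UNIV])
    show "bounded_clinear (A \<circ> P x)" "bounded_clinear (P x \<circ> A)"
      unfolding comp_def
      by (rule bounded_clinear_compose[OF A P_bounded[OF x]] bounded_clinear_compose[OF P_bounded[OF x] A])+
    have "P x (a (i, w)) = (if path_end G (fst i) w = x then a (i, w) else 0)" for i w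
      unfolding a_def by (rule P_word_family[OF vx Pu x])
    moreover have "P x (e (i, w)) = (if path_end G (fst i) w = x then e (i, w) else 0)" for i w
      unfolding e_def by (rule P_word_family[OF vx Pb x])
    ultimately show "(A \<circ> P x) (a p) = (P x \<circ> A) (a p)" for p
      by (cases p) (simp add: Aa bounded_clinearD(4)[OF A])
  qed (rule total_a, simp)
  moreover have "A \<circ> S f = S f \<circ> A" if f: "f \<in> arcs G" for f
  proof (rule bounded_clinear_eq_on_total[where a = a and I = UNIV])
    show "bounded_clinear (A \<circ> S f)" "bounded_clinear (S f \<circ> A)"
      unfolding comp_def
      by (rule bounded_clinear_compose[OF A S_bounded[OF f]] bounded_clinear_compose[OF S_bounded[OF f] A])+
    have "S f (a (i, w)) = a (i, f # w)" "S f (e (i, w)) = e (i, f # w)" for i w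
      unfolding a_def e_def by (rule S_word_family[OF f])+
    then show "(A \<circ> S f) (a p) = (S f \<circ> A) (a p)" for p
      by (cases p) (simp add: Aa)
  qed (rule total_a, simp)
  ultimately show ?thesis using A AA by blast
qed

end

theorem theorem3p2:
  fixes G :: "('v, 'e) pre_digraph"
    and P :: "'v \<Rightarrow> 'h::complex_hilbert_space \<Rightarrow> 'h"
    and S :: "'e \<Rightarrow> 'h \<Rightarrow> 'h"
    and Y :: "'h \<Rightarrow> 'h"
  assumes "wf_digraph G" and "countable (verts G)" and "countable (arcs G)"
    and "no_sinks G"
    and "dagger_family G P S"
    and "pure_family G S"
    and "positive_op Y" and "invertible_op Y"
  shows "(\<exists>A. bounded_clinear A \<and> Y = cadjoint A \<circ> A \<and>
            (\<forall>x\<in>verts G. A \<circ> P x = P x \<circ> A) \<and>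
            (\<forall>e\<in>arcs G. A \<circ> S e = S e \<circ> A))
     \<longleftrightarrow> (\<forall>e\<in>arcs G. \<forall>f\<in>arcs G.
            cadjoint (S e) \<circ> Y \<circ> S f = Y \<circ> cadjoint (S e) \<circ> S f \<and>
            Y \<circ> cadjoint (S e) \<circ> S f = cadjoint (S e) \<circ> S f \<circ> Y)"
    (is "?L \<longleftrightarrow> ?R")
proof -
  interpret dagger_graph G P S by (rule dagger_graph.intro[OF assms(1,5)])
  have Y: "bounded_clinear Y" using assms by (simp add: positive_op_def)
  show ?thesis
  proof
    assume ?L
    then obtain A where A: "bounded_clinear A" and YA: "Y = cadjoint A \<circ> A"
      and "\<forall>x\<in>verts G. A \<circ> P x = P x \<circ> A" "\<forall>e\<in>arcs G. A \<circ> S e = S e \<circ> A" by blast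
    then have AP: "\<And>x h. x \<in> verts G \<Longrightarrow> A (P x h) = P x (A h)"
      and AS: "\<And>e h. e \<in> arcs G \<Longrightarrow> A (S e h) = S e (A h)"
      by (simp_all add: fun_eq_iff)
    note gram = gram_of_commuting_toeplitz[OF A AP AS]
    have YP: "Y (P x h) = P x (Y h)" if "x \<in> verts G" for x h
      using gram(1)[OF _ _ that] by (simp add: YA)
    have YS: "cadjoint (S e) (Y (S f h)) = (if e = f then Y (P (tail G e) h) else 0)"
      if "e \<in> arcs G" "f \<in> arcs G" for e f h
      using gram(2)[OF _ _ that] by (simp add: YA)
    show ?R
      by (auto simp: fun_eq_iff YS cadjoint_S_S YP[OF tail_verts] bounded_clinearD(4)[OF Y])
  next
    assume R: ?R
    then have R1: "cadjoint (S e) (Y (S f h)) = Y (cadjoint (S e) (S f h))"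
      and R2: "Y (cadjoint (S e) (S f h)) = cadjoint (S e) (S f (Y h))"
      if "e \<in> arcs G" "f \<in> arcs G" for e f h
      using that by (simp_all add: fun_eq_iff)
    have "Y (P x h) = P x (Y h)" if x: "x \<in> verts G" for x h
    proof -
      obtain e where e: "e \<in> arcs G" "tail G e = x"
        using \<open>no_sinks G\<close> x unfolding no_sinks_def by blast
      then show ?thesis using R2[OF e(1) e(1), of h] by (simp add: cadjoint_S_S)
    qed
    moreover have "cadjoint (S e) (Y (S f h)) = (if e = f then Y (P (tail G e) h) else 0)"
      if "e \<in> arcs G" "f \<in> arcs G" for e f h
      using R1[OF that] bounded_clinearD(4)[OF Y] by (simp add: cadjoint_S_S that)
    ultimately show ?L
      using toeplitz_factorisation[OF assms(4,6,7,8)] by (metis (no_types, lifting))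
  qed
qed

end
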